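(* Let $n=2$ and $m_1=m_2=m$, and let $k=k(m)\ge 1$ be an integer. If $k=o(m^{2/3})$, then as $m\to\infty$ $$\Pr\left[\text{the clockwork best-response dynamic on } G_{2,(m,m)} \text{ converges to a } 2k\text{-cycle}\right]\sim 2\sqrt{\frac{\pi}{m}}\left(1-\Phi\left(\frac{2k-1}{\sqrt{2m}}\right)\right).$$ If $k=o(\sqrt{m})$, then as $m\to\infty$ this probability is asymptotically $\sqrt{\pi/m}$.
   Context: A random 2-player game $G_{2,(m,m)}$: each player $i\in\{1,2\}$ has actions $[m]=\{1,\dots,m\}$; payoffs $U_i(\mathbf{a})$ for $\mathbf{a}\in[m]^2$ are drawn independently from a fixed atomless distribution on $\mathbb{R}$; the best response $B_i(a_{-i})=\arg\max_{x\in[m]}U_i(x,a_{-i})$ is a.s. unique. The clockwork sequence is $s_{\texttt{c}}(t)=1+((t-1)\bmod 2)$. The clockwork best-response dynamic: $\mathbf{A}^0$ uniform on $[m]^2$ independent of payoffs; for $t\ge 1$ with $i=s_{\texttt{c}}(t)$, $A^t_{-i}=A^{t-1}_{-i}$ and $A^t_i=B_i(A^{t-1}_{-i})$. The dynamic converges to a $2k$-cycle if $\inf\{\tau\ge 1:\mathbf{A}^\tau=\mathbf{A}^{\tau+2k}\text{ and }\mathbf{A}^\tau\ne\mathbf{A}^{\tau+2k'}\text{ for all }1\le k'<k\}$ is finite. $\Phi$ is the standard normal CDF. $f\sim g$ means $f/g\to1$; $f=o(g)$ means $f/g\to 0$ as $m\to\infty$. *)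

theory Defs
  imports "HOL-Probability.Probability" "HOL-Library.Landau_Symbols"
begin

text \<open>Payoff assignment: U (i, (a1, a2)) is the payoff U_i(a1,a2) of player i in {1,2}
  at profile (a1,a2) in [m]^2.  Profiles are pairs (a1, a2).\<close>

type_synonym payoffs = "nat \<times> (nat \<times> nat) \<Rightarrow> real"
type_synonym profile = "nat \<times> nat"

definition payoff_index :: "nat \<Rightarrow> (nat \<times> (nat \<times> nat)) set" where
  "payoff_index m = {1,2} \<times> ({1..m} \<times> {1..m})"

text \<open>Best responses (the argmax is a.s. unique).\<close>
definition best_resp1 :: "nat \<Rightarrow> payoffs \<Rightarrow> nat \<Rightarrow> nat" where
  "best_resp1 m U a2 = arg_max_on (\<lambda>x. U (1, (x, a2))) {1..m}"

definition best_resp2 :: "nat \<Rightarrow> payoffs \<Rightarrow> nat \<Rightarrow> nat" where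
  "best_resp2 m U a1 = arg_max_on (\<lambda>x. U (2, (a1, x))) {1..m}"

definition clockwork :: "nat \<Rightarrow> nat" where
  "clockwork t = 1 + ((t - 1) mod 2)"

fun cw_dyn :: "nat \<Rightarrow> payoffs \<Rightarrow> profile \<Rightarrow> nat \<Rightarrow> profile" where
  "cw_dyn m U a0 0 = a0"
| "cw_dyn m U a0 (Suc t) =
     (let A = cw_dyn m U a0 t in
      if clockwork (Suc t) = 1 then (best_resp1 m U (snd A), snd A)
      else (fst A, best_resp2 m U (fst A)))"

definition converges_to_cycle :: "nat \<Rightarrow> payoffs \<Rightarrow> profile \<Rightarrow> nat \<Rightarrow> bool" where
  "converges_to_cycle m U a0 k \<longleftrightarrow>
     (\<exists>\<tau>\<ge>1. cw_dyn m U a0 \<tau> = cw_dyn m U a0 (\<tau> + 2*k) \<and>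
        (\<forall>k'. 1 \<le> k' \<and> k' < k \<longrightarrow> cw_dyn m U a0 \<tau> \<noteq> cw_dyn m U a0 (\<tau> + 2*k')))"

definition game_space :: "real measure \<Rightarrow> nat \<Rightarrow> (payoffs \<times> profile) measure" where
  "game_space D m =
     pair_measure (PiM (payoff_index m) (\<lambda>_. D)) (uniform_count_measure ({1..m} \<times> {1..m}))"

definition cycle_prob :: "real measure \<Rightarrow> nat \<Rightarrow> nat \<Rightarrow> real" where
  "cycle_prob D m k =
     measure (game_space D m)
       {\<omega> \<in> space (game_space D m). converges_to_cycle m (fst \<omega>) (snd \<omega>) k}"

definition Phi :: "real \<Rightarrow> real" where
  "Phi x = measure (density lborel std_normal_density) {..x}"

end

theory Submission
  imports Defs "HOL-Real_Asymp.Real_Asymp"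
begin

text \<open>Because the payoff distribution is atomless, ties have probability zero, and by symmetry
  under permuting the payoffs the best responses to the \<open>2 * m\<close> opponent actions are independent
  and uniform. The dynamic is therefore the orbit of a random map on a bipartite set of \<open>2 * m\<close>
  nodes, and it reaches a \<open>2k\<close>-cycle iff at the time \<open>T\<close> of its first repetition it jumps back by
  exactly \<open>2 * k\<close> steps. Summing over \<open>T\<close> gives the exact birthday-type formula
  \<open>(\<Sum>T=2k..2m. \<Prod>j<T. 1 - \<lfloor>j/2\<rfloor>/m) / m\<close>. The product is \<open>exp (- (T-1)\<^sup>2 / (4 m) + O(T\<^sup>3 / m\<^sup>2))\<close>,
  and only the \<open>T\<close> within \<open>m powr (3/5)\<close> of \<open>2k\<close> matter, so for \<open>k = o(m powr (2/3))\<close> the sum is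
  asymptotic to a Gaussian tail integral.\<close>

section \<open>The normal distribution function\<close>

interpretation std_normal: real_distribution std_normal_distribution
  by (rule real_dist_normal_dist)

lemma Phi_eq_cdf: "Phi = cdf std_normal_distribution"
  by (simp add: fun_eq_iff Phi_def cdf_def)

lemma Phi_le_1: "Phi x \<le> 1"
  unfolding Phi_eq_cdf by (rule std_normal.cdf_bounded_prob)

lemma measure_std_normal_distribution:
  assumes "A \<in> sets borel"
  shows "measure std_normal_distribution A = (LBINT x:A. std_normal_density x)"
proof -
  have "measure std_normal_distribution A = (\<integral>x. indicator A x \<partial>std_normal_distribution)"
    using assms by simp
  also have "\<dots> = (LBINT x:A. std_normal_density x)"
    using assms unfolding set_lebesgue_integral_def by (subst integral_density) (auto simp: mult.commute)
  finally show ?thesis .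
qed

lemma set_integrable_std_normal_density:
  "A \<in> sets borel \<Longrightarrow> set_integrable lborel A std_normal_density"
  unfolding set_integrable_def by (rule integrable_mult_indicator) simp_all

lemma one_minus_Phi_eq: "1 - Phi x = (LBINT y:{x<..}. std_normal_density y)"
proof -
  have "{x<..} = space std_normal_distribution - {..x}" by auto
  then show ?thesis
    using std_normal.prob_compl[of "{..x}"] by (simp add: Phi_def flip: measure_std_normal_distribution)
qed

lemma Phi_minus: "Phi (- x) = 1 - Phi x"
proof -
  have "Phi (- x) = (LBINT y:{..- x}. std_normal_density y)"
    by (simp add: Phi_def measure_std_normal_distribution)
  also have "\<dots> = (LBINT y:{x..}. std_normal_density (- y))"
    by (subst set_integral_reflect) (simp add: atLeast_def)
  also have "\<dots> = (LBINT y:{x..}. std_normal_density y)"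
    by (simp add: std_normal_density_def)
  also have "\<dots> = (LBINT y:{x<..}. std_normal_density y)"
    unfolding set_lebesgue_integral_def using AE_lborel_singleton[of x]
    by (intro integral_cong_AE) (auto elim!: eventually_mono split: split_indicator)
  finally show ?thesis by (simp add: one_minus_Phi_eq)
qed

lemma Phi_diff_eq_integral:
  assumes "a < b"
  shows "Phi b - Phi a = integral {a..b} std_normal_density"
proof -
  have "Phi b - Phi a = measure std_normal_distribution {a<..b}"
    unfolding Phi_eq_cdf using assms by (rule std_normal.cdf_diff_eq)
  also have "\<dots> = (LBINT x=a..b. std_normal_density x)"
    using assms by (simp add: measure_std_normal_distribution interval_integral_Ioc)
  also have "\<dots> = integral {a..b} std_normal_density"
    using assms by (intro interval_integral_eq_integral set_integrable_std_normal_density) auto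
  finally show ?thesis .
qed

lemma DERIV_Phi: "(Phi has_real_derivative std_normal_density x) (at x)"
proof -
  let ?F = "\<lambda>y. Phi (x - 1) + integral {x - 1..y} std_normal_density"
  have "(?F has_real_derivative 0 + std_normal_density x) (at x within {x - 1..x + 1})"
    by (intro DERIV_add DERIV_const integral_has_real_derivative)
      (auto simp: std_normal_density_def intro!: continuous_intros)
  then have "(?F has_real_derivative std_normal_density x) (at x)"
    by (simp add: at_within_Icc_at)
  then show ?thesis
  proof (rule has_field_derivative_transform_within_open)
    show "open {x - 1<..<x + 1}" "x \<in> {x - 1<..<x + 1}" by auto
    show "?F y = Phi y" if "y \<in> {x - 1<..<x + 1}" for y
      using that Phi_diff_eq_integral[of "x - 1" y] by simp
  qed
qed

lemma isCont_Phi: "isCont Phi x"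
  using DERIV_Phi by (rule DERIV_isCont)

lemma Phi_less_1: "Phi x < 1"
proof -
  have "Phi x < Phi (x + 1)"
    by (rule DERIV_pos_imp_increasing) (auto intro!: exI DERIV_Phi normal_density_pos)
  also have "\<dots> \<le> 1" by (rule Phi_le_1)
  finally show ?thesis .
qed

lemma std_normal_density_add:
  "std_normal_density (x + y) = exp (- x\<^sup>2 / 2 - x * y) * std_normal_density y"
proof -
  have "- (x + y)\<^sup>2 / 2 = - x\<^sup>2 / 2 - x * y + - y\<^sup>2 / 2"
    by (simp add: power2_sum field_simps)
  then show ?thesis
    unfolding std_normal_density_def by (simp only: exp_add mult_ac)
qed

lemma one_minus_Phi_add_le:
  assumes "0 \<le> x" "0 \<le> d"
  shows "1 - Phi (x + d) \<le> exp (- d\<^sup>2 / 2) * (1 - Phi x)"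
proof -
  have "1 - Phi (x + d) = (LBINT y:{x<..}. std_normal_density (d + y))"
    unfolding one_minus_Phi_eq set_lebesgue_integral_def
    by (subst lborel_integral_real_affine[where c = 1 and t = d])
      (auto intro!: Bochner_Integration.integral_cong split: split_indicator)
  also have "\<dots> \<le> (LBINT y:{x<..}. exp (- d\<^sup>2 / 2) * std_normal_density y)"
  proof (rule set_integral_mono)
    have "integrable lborel (\<lambda>y. std_normal_density (d + 1 * y))"
      by (rule lborel_integrable_real_affine) simp_all
    then show "set_integrable lborel {x<..} (\<lambda>y. std_normal_density (d + y))"
      unfolding set_integrable_def by (intro integrable_mult_indicator) simp_all
    show "set_integrable lborel {x<..} (\<lambda>y. exp (- d\<^sup>2 / 2) * std_normal_density y)"
      by (intro set_integrable_mult_right set_integrable_std_normal_density) simp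
    show "std_normal_density (d + y) \<le> exp (- d\<^sup>2 / 2) * std_normal_density y" if "y \<in> {x<..}" for y
      unfolding std_normal_density_add using that assms by (intro mult_right_mono) auto
  qed
  also have "\<dots> = exp (- d\<^sup>2 / 2) * (1 - Phi x)"
    by (simp add: one_minus_Phi_eq)
  finally show ?thesis .
qed

section \<open>Orbits of iterated maps\<close>

lemma funpow_eq_add:
  fixes f :: "'a \<Rightarrow> 'a"
  assumes "(f ^^ i) x = (f ^^ j) x"
  shows "(f ^^ (i + n)) x = (f ^^ (j + n)) x"
  by (induction n) (simp_all add: assms)

lemma funpow_eq_add_mult:
  fixes f :: "'a \<Rightarrow> 'a"
  assumes "(f ^^ (s + p)) x = (f ^^ s) x" and "s \<le> t"
  shows "(f ^^ (t + n * p)) x = (f ^^ t) x"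
proof -
  have period: "(f ^^ (t + p)) x = (f ^^ t) x"
    using funpow_eq_add[OF assms(1), of "t - s"] \<open>s \<le> t\<close> by (simp add: add.commute)
  show ?thesis
  proof (induction n)
    case (Suc n)
    then have "(f ^^ (t + n * p + p)) x = (f ^^ (t + p)) x" by (rule funpow_eq_add)
    with period show ?case by (simp add: add_ac)
  qed simp
qed

lemma inj_on_funpow_least_period:
  fixes f :: "'a \<Rightarrow> 'a" and x :: 'a
  defines "z \<equiv> \<lambda>t. (f ^^ t) x"
  assumes closes: "z (s + p) = z s" and "p \<ge> 1"
    and least: "\<And>i. i < s \<Longrightarrow> z (i + p) \<noteq> z i"
    and minimal: "\<And>q. 1 \<le> q \<Longrightarrow> q < p \<Longrightarrow> z (s + q) \<noteq> z s"
  shows "inj_on z {..<s + p}"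
proof -
  have "z i \<noteq> z j" if "i < j" "j < s + p" for i j
  proof
    assume eq: "z i = z j"
    define q where "q = j - i"
    have q: "q \<ge> 1" "z (i + q) = z i" using that eq by (auto simp: q_def)
    show False
    proof (cases "s \<le> i")
      case True
      let ?t = "s + i * p"
      have "i \<le> ?t" using \<open>p \<ge> 1\<close> by (simp add: trans_le_add2)
      with q(2) have "z (?t + q) = z ?t" using funpow_eq_add_mult[of i q f x ?t 1] by (simp add: z_def)
      moreover have "z ?t = z s" using closes by (simp add: z_def funpow_eq_add_mult)
      moreover from this have "z (?t + q) = z (s + q)"
        unfolding z_def by (rule funpow_eq_add)
      moreover have "q < p" using that True by (simp add: q_def)
      ultimately show False using minimal q(1) by simp
    next
      case False
      let ?t = "i + s * q"
      have "s \<le> ?t" using q(1) by (simp add: trans_le_add2)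
      with closes have "z (?t + p) = z ?t" using funpow_eq_add_mult[of s p f x ?t 1] by (simp add: z_def)
      moreover have "z ?t = z i" using q(2) by (simp add: z_def funpow_eq_add_mult)
      moreover from this have "z (?t + p) = z (i + p)"
        unfolding z_def by (rule funpow_eq_add)
      ultimately show False using least[of i] False by simp
    qed
  qed
  then show ?thesis by (intro linorder_inj_onI') simp
qed

lemma funpow_period_iff_inj_on:
  fixes f :: "'a \<Rightarrow> 'a" and x :: 'a
  defines "z \<equiv> \<lambda>t. (f ^^ t) x"
  assumes "p \<ge> 1"
  shows "(\<exists>s. z (s + p) = z s \<and> (\<forall>q. 1 \<le> q \<and> q < p \<longrightarrow> z (s + q) \<noteq> z s)) \<longleftrightarrow>
         (\<exists>s. z (s + p) = z s \<and> inj_on z {..<s + p})" (is "?L \<longleftrightarrow> ?R")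
proof
  assume ?R
  then obtain s where s: "z (s + p) = z s" "inj_on z {..<s + p}" by blast
  have "z (s + q) \<noteq> z s" if "1 \<le> q \<and> q < p" for q
    using inj_on_eq_iff[OF s(2), of "s + q" s] that by simp
  with s(1) show ?L by blast
next
  assume ?L
  then obtain s0 where s0: "z (s0 + p) = z s0" and minimal: "\<And>q. 1 \<le> q \<Longrightarrow> q < p \<Longrightarrow> z (s0 + q) \<noteq> z s0"
    by blast
  define s where "s = (LEAST s. z (s + p) = z s)"
  have s: "z (s + p) = z s" "s \<le> s0"
    unfolding s_def using s0 by (auto intro: LeastI Least_le)
  have "z (s + q) \<noteq> z s" if "1 \<le> q" "q < p" for q
    using minimal[OF that] funpow_eq_add[of "s + q" f x s "s0 - s"] \<open>s \<le> s0\<close>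
    by (auto simp: z_def add_ac)
  moreover have "z (i + p) \<noteq> z i" if "i < s" for i
    using not_less_Least that unfolding s_def by blast
  ultimately have "inj_on z {..<s + p}"
    using s(1) assms(2) unfolding z_def by (intro inj_on_funpow_least_period) auto
  with s(1) show ?R by blast
qed

text \<open>An orbit traces a letter rho: it visits distinct points and then jumps back \<open>p\<close> places.\<close>

definition rho_path :: "('a \<Rightarrow> 'a) \<Rightarrow> nat \<Rightarrow> 'a list \<Rightarrow> bool" where
  "rho_path f p vs \<longleftrightarrow>
     distinct vs \<and> p \<in> {1..length vs} \<and> map f vs = tl vs @ [vs ! (length vs - p)]"

lemma rho_path_nth:
  assumes "rho_path f p vs" "j < length vs"
  shows "vs ! j = (f ^^ j) (hd vs)"
  using assms(2)
proof (induction j)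
  case 0
  then show ?case by (simp add: hd_conv_nth)
next
  case (Suc j)
  then have "vs ! Suc j = (tl vs @ [vs ! (length vs - p)]) ! j"
    by (auto simp: nth_append nth_tl)
  also have "\<dots> = map f vs ! j" using assms(1) by (simp add: rho_path_def)
  finally show ?case using Suc by simp
qed

lemma rho_path_eq_map_funpow:
  assumes "rho_path f p vs"
  shows "vs = map (\<lambda>t. (f ^^ t) (hd vs)) [0..<length vs]"
  by (rule nth_equalityI) (simp_all add: rho_path_nth[OF assms])

lemma rho_path_map_funpow_iff:
  assumes "p \<ge> 1"
  shows "rho_path f p (map (\<lambda>t. (f ^^ t) x) [0..<s + p]) \<longleftrightarrow>
    (f ^^ (s + p)) x = (f ^^ s) x \<and> inj_on (\<lambda>t. (f ^^ t) x) {..<s + p}"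
proof -
  let ?z = "\<lambda>t. (f ^^ t) x"
  let ?vs = "map ?z [0..<s + p]"
  obtain n where n: "s + p = Suc n" using assms by (cases "s + p") auto
  have "map f ?vs = map ?z (map Suc [0..<s + p])" by simp
  also have "\<dots> = map ?z [1..<s + p] @ [?z (s + p)]"
    unfolding map_Suc_upt by (simp add: n)
  finally have "map f ?vs = map ?z [1..<s + p] @ [?z (s + p)]" .
  moreover have "tl ?vs = map ?z [1..<s + p]" by (simp add: tl_upt flip: map_tl)
  ultimately show ?thesis
    using assms by (auto simp: rho_path_def distinct_map lessThan_atLeast0)
qed

lemma rho_pathE:
  assumes "rho_path f p vs"
  obtains s where "vs = map (\<lambda>t. (f ^^ t) (hd vs)) [0..<s + p]"
    "(f ^^ (s + p)) (hd vs) = (f ^^ s) (hd vs)" "inj_on (\<lambda>t. (f ^^ t) (hd vs)) {..<s + p}"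
proof -
  have p: "p \<in> {1..length vs}" using assms by (simp add: rho_path_def)
  then obtain s where s: "length vs = s + p" by (metis atLeastAtMost_iff le_add_diff_inverse2)
  have vs: "vs = map (\<lambda>t. (f ^^ t) (hd vs)) [0..<s + p]"
    using rho_path_eq_map_funpow[OF assms] unfolding s .
  have "rho_path f p (map (\<lambda>t. (f ^^ t) (hd vs)) [0..<s + p])" using assms by (subst (asm) vs)
  with p that[OF vs] show ?thesis by (simp add: rho_path_map_funpow_iff)
qed

lemma ex_rho_path_iff:
  assumes "p \<ge> 1"
  shows "(\<exists>vs. rho_path f p vs \<and> hd vs = x) \<longleftrightarrow>
    (\<exists>s. (f ^^ (s + p)) x = (f ^^ s) x \<and> inj_on (\<lambda>t. (f ^^ t) x) {..<s + p})" (is "?L \<longleftrightarrow> ?R")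
proof
  assume ?L
  then obtain vs where vs: "rho_path f p vs" "hd vs = x" by blast
  from vs(1) obtain s where
    "(f ^^ (s + p)) (hd vs) = (f ^^ s) (hd vs)" "inj_on (\<lambda>t. (f ^^ t) (hd vs)) {..<s + p}"
    by (rule rho_pathE)
  then show ?R unfolding vs(2) by (intro exI[of _ s] conjI)
next
  assume ?R
  then obtain s where "(f ^^ (s + p)) x = (f ^^ s) x" "inj_on (\<lambda>t. (f ^^ t) x) {..<s + p}" by blast
  then have "rho_path f p (map (\<lambda>t. (f ^^ t) x) [0..<s + p])"
    unfolding rho_path_map_funpow_iff[OF assms] ..
  moreover have "hd (map (\<lambda>t. (f ^^ t) x) [0..<s + p]) = x" using assms by (simp add: hd_map)
  ultimately show ?L by (intro exI conjI)
qed

lemma rho_path_unique: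
  assumes "rho_path f p vs" "rho_path f p ws" "hd vs = hd ws"
  shows "vs = ws"
proof -
  let ?z = "\<lambda>t. (f ^^ t) (hd vs)"
  obtain s where s: "vs = map ?z [0..<s + p]" "?z (s + p) = ?z s" "inj_on ?z {..<s + p}"
    using assms(1) by (rule rho_pathE)
  obtain r where r: "ws = map ?z [0..<r + p]" "?z (r + p) = ?z r" "inj_on ?z {..<r + p}"
    using assms(2) unfolding assms(3) by (rule rho_pathE)
  have "p \<ge> 1" using assms(1) by (simp add: rho_path_def)
  then have "\<not> s < r" "\<not> r < s"
    using inj_on_eq_iff[OF r(3), of "s + p" s] inj_on_eq_iff[OF s(3), of "r + p" r] s(2) r(2) by auto
  then have "s = r" by simp
  show ?thesis using s(1) unfolding \<open>s = r\<close> r(1)[symmetric] .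
qed

section \<open>Counting lists of distinct elements\<close>

definition distinct_lists_in :: "(nat \<Rightarrow> 'a set) \<Rightarrow> nat \<Rightarrow> 'a list set" where
  "distinct_lists_in B n = {vs. length vs = n \<and> distinct vs \<and> (\<forall>j<n. vs ! j \<in> B j)}"

lemma distinct_lists_in_Suc:
  "distinct_lists_in B (Suc n) =
    (\<lambda>(vs, v). vs @ [v]) ` (SIGMA vs:distinct_lists_in B n. B n - set vs)" (is "?L = ?R")
proof (intro equalityI subsetI)
  fix us assume us: "us \<in> ?L"
  then obtain vs v where "us = vs @ [v]"
    unfolding distinct_lists_in_def by (cases us rule: rev_cases) auto
  with us show "us \<in> ?R"
    by (force simp: distinct_lists_in_def nth_append all_conj_distrib less_Suc_eq)
next
  fix us assume "us \<in> ?R"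
  then show "us \<in> ?L"
    by (auto simp: distinct_lists_in_def nth_append less_Suc_eq)
qed

lemma finite_distinct_lists_in:
  assumes "\<And>j. finite (B j)"
  shows "finite (distinct_lists_in B n)"
proof (induction n)
  case (Suc n)
  then show ?case using assms unfolding distinct_lists_in_Suc by (intro finite_imageI finite_SigmaI) auto
qed (simp add: distinct_lists_in_def)

lemma card_distinct_lists_in:
  assumes "\<And>j. finite (B j)" and disjoint: "\<And>i j. B i = B j \<or> B i \<inter> B j = {}"
  shows "card (distinct_lists_in B n) = (\<Prod>j<n. card (B j) - card {i. i < j \<and> B i = B j})"
proof (induction n)
  case 0
  have "distinct_lists_in B 0 = {[]}" by (auto simp: distinct_lists_in_def)
  then show ?case by simp
next
  case (Suc n)
  let ?same = "{i. i < n \<and> B i = B n}"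
  have card_fresh: "card (B n - set vs) = card (B n) - card ?same" if "vs \<in> distinct_lists_in B n" for vs
  proof -
    from that have vs: "length vs = n" "distinct vs" "\<And>j. j < n \<Longrightarrow> vs ! j \<in> B j"
      by (auto simp: distinct_lists_in_def)
    have "B n \<inter> set vs = (!) vs ` ?same"
      using vs(1,3) disjoint[of _ n] by (fastforce simp: in_set_conv_nth)
    moreover have "inj_on ((!) vs) ?same" using vs by (auto intro: inj_on_nth)
    ultimately show ?thesis by (simp add: card_Diff_subset_Int card_image)
  qed
  have "card (distinct_lists_in B (Suc n)) = card (SIGMA vs:distinct_lists_in B n. B n - set vs)"
    unfolding distinct_lists_in_Suc by (intro card_image inj_onI) auto
  also have "\<dots> = (\<Sum>vs\<in>distinct_lists_in B n. card (B n - set vs))"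
    using assms(1) by (intro card_SigmaI finite_distinct_lists_in) auto
  also have "\<dots> = card (distinct_lists_in B n) * (card (B n) - card ?same)"
    using card_fresh by simp
  finally show ?case using Suc by simp
qed

lemma card_same_parity_less: "card {i. i < n \<and> even i = even n} = n div 2"
proof (induction n rule: induct_nat_012)
  case (ge2 n)
  have "{i. i < Suc (Suc n) \<and> even i = even (Suc (Suc n))} = insert n {i. i < n \<and> even i = even n}"
    by (auto simp: less_Suc_eq)
  then show ?case using ge2 by simp
qed (auto intro: odd_pos)

section \<open>Maximizers of independent random variables\<close>

lemma arg_max_on_eq_arg_min_on_uminus:
  fixes f :: "'a \<Rightarrow> real"
  shows "arg_max_on f X = arg_min_on (\<lambda>x. - f x) X"
  by (simp add: arg_max_on_def arg_max_def is_arg_max_linorder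
      arg_min_on_def arg_min_def is_arg_min_linorder)

lemma arg_max_on_in:
  fixes f :: "'a \<Rightarrow> real"
  shows "finite X \<Longrightarrow> X \<noteq> {} \<Longrightarrow> arg_max_on f X \<in> X"
  unfolding arg_max_on_eq_arg_min_on_uminus by (rule arg_min_if_finite)

lemma arg_max_on_eq_iff:
  fixes f :: "'a \<Rightarrow> real"
  assumes "finite X" "inj_on f X" "b \<in> X"
  shows "arg_max_on f X = b \<longleftrightarrow> (\<forall>x\<in>X. f x \<le> f b)"
proof
  assume "arg_max_on f X = b"
  then show "\<forall>x\<in>X. f x \<le> f b"
    using arg_min_least[of X _ "\<lambda>x. - f x"] assms unfolding arg_max_on_eq_arg_min_on_uminus by auto
next
  assume "\<forall>x\<in>X. f x \<le> f b"
  then show "arg_max_on f X = b"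
    unfolding arg_max_on_eq_arg_min_on_uminus arg_min_on_def using assms
    by (intro arg_min_inj_eq) (auto simp: inj_on_def)
qed

lemma arg_max_on_reindex_eq_iff:
  fixes f :: "'a \<Rightarrow> real"
  assumes "finite X" "inj_on f X" "b \<in> X" "bij_betw g X X"
  shows "arg_max_on (\<lambda>x. f (g x)) X = b \<longleftrightarrow> arg_max_on f X = g b"
proof -
  have g: "g ` X = X" "inj_on g X" using assms(4) by (auto simp: bij_betw_def)
  have "inj_on (\<lambda>x. f (g x)) X"
    using comp_inj_on[of g X f] assms(2) g by (simp add: comp_def)
  then have "arg_max_on (\<lambda>x. f (g x)) X = b \<longleftrightarrow> (\<forall>x\<in>g ` X. f x \<le> f (g b))"
    using assms by (subst arg_max_on_eq_iff) auto
  also have "\<dots> \<longleftrightarrow> arg_max_on f X = g b"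
    using assms(1-3) g by (subst arg_max_on_eq_iff) auto
  finally show ?thesis .
qed

lemma arg_max_on_transpose_eq_iff:
  fixes f :: "'a \<Rightarrow> real"
  assumes "finite X" "inj_on f X" "a \<in> X" "b \<in> X"
  shows "arg_max_on (\<lambda>x. f (Transposition.transpose a b x)) X = a \<longleftrightarrow> arg_max_on f X = b"
  using arg_max_on_reindex_eq_iff[of X f a "Transposition.transpose a b"] assms
  by (simp add: bij_betw_transpose_iff)

lemma arg_max_on_cong:
  fixes f g :: "'a \<Rightarrow> real"
  assumes "\<And>x. x \<in> X \<Longrightarrow> f x = g x"
  shows "arg_max_on f X = arg_max_on g X"
  unfolding arg_max_on_def arg_max_def is_arg_max_linorder using assms
  by (intro arg_cong[of _ _ Eps] ext) auto

lemma measurable_arg_max_on: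
  fixes F :: "'a \<Rightarrow> 'b \<Rightarrow> real"
  assumes "finite X" and "\<And>x. x \<in> X \<Longrightarrow> (\<lambda>\<omega>. F \<omega> x) \<in> borel_measurable M"
  shows "(\<lambda>\<omega>. arg_max_on (F \<omega>) X) \<in> M \<rightarrow>\<^sub>M count_space UNIV"
proof -
  define maximizers where "maximizers \<omega> = {x\<in>X. \<forall>y\<in>X. F \<omega> y \<le> F \<omega> x}" for \<omega>
  have "maximizers \<in> M \<rightarrow>\<^sub>M count_space (Pow X)"
  proof (subst measurable_count_space_eq2)
    have "maximizers -` {A} \<inter> space M \<in> sets M" if "A \<subseteq> X" for A
    proof -
      have "finite A" "finite (X - A)" using that \<open>finite X\<close> by (auto intro: finite_subset)
      have "{x\<in>X. P x} = A \<longleftrightarrow> (\<forall>x\<in>A. P x) \<and> (\<forall>x\<in>X - A. \<not> P x)" for P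
        using that by blast
      then have maximizers_eq_iff: "maximizers \<omega> = A \<longleftrightarrow>
          (\<forall>x\<in>A. \<forall>y\<in>X. F \<omega> y \<le> F \<omega> x) \<and> (\<forall>x\<in>X - A. \<not> (\<forall>y\<in>X. F \<omega> y \<le> F \<omega> x))" for \<omega>
        unfolding maximizers_def .
      have "{\<omega>\<in>space M. maximizers \<omega> = A} \<in> sets M"
        unfolding maximizers_eq_iff using that assms \<open>finite A\<close> \<open>finite (X - A)\<close>
        by (intro sets.sets_Collect_conj sets.sets_Collect_neg sets.sets_Collect_finite_All
            borel_measurable_le) auto
      then show ?thesis by (simp add: vimage_def Int_def conj_commute)
    qed
    then show "maximizers \<in> space M \<rightarrow> Pow X \<and> (\<forall>A\<in>Pow X. maximizers -` {A} \<inter> space M \<in> sets M)"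
      by (auto simp: maximizers_def)
  qed (use \<open>finite X\<close> in auto)
  then have "(\<lambda>\<omega>. SOME x. x \<in> maximizers \<omega>) \<in> M \<rightarrow>\<^sub>M count_space UNIV"
    by (rule measurable_compose) simp
  then show ?thesis
    by (simp add: arg_max_on_def arg_max_def is_arg_max_linorder maximizers_def Ball_def)
qed

locale atomless_distribution = real_distribution D for D :: "real measure" +
  assumes measure_singleton_eq_0: "measure D {x} = 0"
begin

abbreviation iid :: "'i set \<Rightarrow> ('i \<Rightarrow> real) measure" where
  "iid I \<equiv> PiM I (\<lambda>_. D)"

lemma prob_space_iid: "prob_space (iid I)"
  by (intro prob_space_PiM prob_space_axioms)

lemma borel_measurable_iid_component:
  assumes "i \<in> I"
  shows "(\<lambda>U. U i) \<in> borel_measurable (iid I)"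
  using measurable_component_singleton[OF assms, of "\<lambda>_. D"] by (simp cong: measurable_cong_sets)

lemma AE_iid_neq:
  assumes "p \<in> I" "q \<in> I" "p \<noteq> q"
  shows "AE U in iid I. U p \<noteq> U q"
proof -
  let ?J = "I - {p}"
  let ?N = "D \<Otimes>\<^sub>M iid ?J" and ?insert = "\<lambda>(x, V). V(p := x)"
  interpret J: prob_space "iid ?J" by (rule prob_space_iid)
  interpret pair_sigma_finite D "iid ?J" ..
  have "insert p ?J = I" using assms(1) by auto
  have [measurable]: "(\<lambda>U. U q) \<in> borel_measurable (iid ?J)"
    using assms by (intro borel_measurable_iid_component) auto
  have "AE y in D. x \<noteq> y" for x
    using measure_singleton_eq_0[of x] by (intro AE_I[of _ _ "{x}"]) (auto simp: emeasure_eq_measure)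
  then have neq: "AE V in iid ?J. x \<noteq> V q" for x
    using assms by (intro AE_PiM_component[where i = q and P = "(\<noteq>) x"] prob_space_axioms) auto
  have "AE z in ?N. fst z \<noteq> snd z q"
  proof (rule AE_pair_measure)
    show "{z \<in> space ?N. fst z \<noteq> snd z q} \<in> sets ?N"
      by (rule borel_measurable_neq) measurable
  qed (simp add: neq)
  moreover have "?insert \<in> ?N \<rightarrow>\<^sub>M iid I"
    unfolding split_beta using assms(1) by (intro measurable_fun_upd[of _ ?J]) auto
  moreover have "{U \<in> space (iid I). U p \<noteq> U q} \<in> sets (iid I)"
    using assms by (intro borel_measurable_neq borel_measurable_iid_component)
  ultimately have "AE U in distr ?N (iid I) ?insert. U p \<noteq> U q"
    using assms(3) by (simp add: AE_distr_iff split_beta)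
  moreover have "distr ?N (iid I) ?insert = iid I"
    using distr_pair_PiM_eq_PiM[of ?J "\<lambda>_. D" p, OF prob_space_axioms prob_space_axioms]
    unfolding \<open>insert p ?J = I\<close> .
  ultimately show ?thesis by (simp only:)
qed

lemma AE_iid_inj_on:
  assumes "finite I"
  shows "AE U in iid I. inj_on U I"
proof -
  have "AE U in iid I. \<forall>p\<in>I. \<forall>q\<in>I. p \<noteq> q \<longrightarrow> U p \<noteq> U q"
    using assms AE_iid_neq by (intro AE_finite_allI) auto
  then show ?thesis by eventually_elim (auto simp: inj_on_def)
qed

lemma measurable_iid_reindex:
  assumes "f ` J \<subseteq> I"
  shows "(\<lambda>U. \<lambda>j\<in>J. U (f j)) \<in> iid I \<rightarrow>\<^sub>M iid J"
  using assms by (intro measurable_restrict measurable_component_singleton) auto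

lemma sets_iid_reindex:
  assumes "f ` J \<subseteq> I" "A \<in> sets (iid J)"
  shows "{U\<in>space (iid I). (\<lambda>j\<in>J. U (f j)) \<in> A} \<in> sets (iid I)"
  using measurable_sets[OF measurable_iid_reindex[OF assms(1)] assms(2)]
  by (simp add: vimage_def Int_def conj_commute)

lemma prob_iid_reindex:
  assumes "inj_on f J" "f ` J \<subseteq> I" "A \<in> sets (iid J)"
  shows "measure (iid I) {U\<in>space (iid I). (\<lambda>j\<in>J. U (f j)) \<in> A} = measure (iid J) A"
proof -
  let ?r = "\<lambda>U. \<lambda>j\<in>J. U (f j)"
  have "measure (iid J) A = measure (distr (iid I) (iid J) ?r) A"
    using distr_PiM_reindex[of I "\<lambda>_. D" f J] assms(1,2) by (simp add: prob_space_axioms image_subset_iff)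
  also have "\<dots> = measure (iid I) (?r -` A \<inter> space (iid I))"
    using measurable_iid_reindex[OF assms(2)] assms(3) by (rule measure_distr)
  finally show ?thesis by (simp add: vimage_def Int_def conj_commute)
qed

definition arg_max_event :: "'v set \<Rightarrow> 'c set \<Rightarrow> ('v \<Rightarrow> 'c) \<Rightarrow> ('v \<times> 'c \<Rightarrow> real) set" where
  "arg_max_event V C h = {U\<in>space (iid (V \<times> C)). \<forall>v\<in>V. arg_max_on (\<lambda>x. U (v, x)) C = h v}"

lemma sets_arg_max_event:
  assumes "finite V" "finite C"
  shows "arg_max_event V C h \<in> sets (iid (V \<times> C))"
proof -
  have [measurable]: "(\<lambda>U. arg_max_on (\<lambda>x. U (v, x)) C) \<in> iid (V \<times> C) \<rightarrow>\<^sub>M count_space UNIV"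
    if "v \<in> V" for v
    using assms(2) that by (intro measurable_arg_max_on borel_measurable_iid_component) auto
  show ?thesis unfolding arg_max_event_def using \<open>finite V\<close> by measurable
qed

lemma AE_transpose_in_arg_max_event_iff:
  assumes "finite V" "finite C" and g: "g \<in> V \<rightarrow> C" and h: "h \<in> V \<rightarrow> C"
  defines "\<pi> \<equiv> \<lambda>(v, x). (v, Transposition.transpose (g v) (h v) x)"
  shows "\<pi> ` (V \<times> C) \<subseteq> V \<times> C"
    and "AE U in iid (V \<times> C). (\<lambda>p\<in>V \<times> C. U (\<pi> p)) \<in> arg_max_event V C g \<longleftrightarrow> U \<in> arg_max_event V C h"
proof -
  let ?permute = "\<lambda>U. \<lambda>p\<in>V \<times> C. U (\<pi> p)"
  show \<pi>: "\<pi> ` (V \<times> C) \<subseteq> V \<times> C"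
    using Pi_mem[OF g] Pi_mem[OF h] by (auto simp: \<pi>_def Transposition.transpose_def)
  have "AE U in iid (V \<times> C). inj_on U (V \<times> C)"
    using assms(1,2) by (intro AE_iid_inj_on) auto
  then show "AE U in iid (V \<times> C). ?permute U \<in> arg_max_event V C g \<longleftrightarrow> U \<in> arg_max_event V C h"
    using AE_space
  proof eventually_elim
    case (elim U)
    have "arg_max_on (\<lambda>x. ?permute U (v, x)) C = g v \<longleftrightarrow> arg_max_on (\<lambda>x. U (v, x)) C = h v"
      if v: "v \<in> V" for v
    proof -
      have "arg_max_on (\<lambda>x. ?permute U (v, x)) C =
          arg_max_on (\<lambda>x. U (v, Transposition.transpose (g v) (h v) x)) C"
        using v by (intro arg_max_on_cong) (simp add: \<pi>_def)
      moreover have "inj_on (\<lambda>x. U (v, x)) C" using elim(1) v by (auto simp: inj_on_def)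
      ultimately show ?thesis
        using arg_max_on_transpose_eq_iff[of C "\<lambda>x. U (v, x)"] \<open>finite C\<close> Pi_mem[OF g v] Pi_mem[OF h v]
        by simp
    qed
    with measurable_space[OF measurable_iid_reindex[OF \<pi>] elim(2)] elim(2)
    show ?case by (simp only: arg_max_event_def mem_Collect_eq cong: ball_cong)
  qed
qed

lemma prob_arg_max_event_cong:
  assumes "finite V" "finite C" "g \<in> V \<rightarrow> C" "h \<in> V \<rightarrow> C"
  shows "measure (iid (V \<times> C)) (arg_max_event V C g) = measure (iid (V \<times> C)) (arg_max_event V C h)"
proof -
  interpret P: prob_space "iid (V \<times> C)" by (rule prob_space_iid)
  define \<pi> where "\<pi> = (\<lambda>(v, x). (v, Transposition.transpose (g v) (h v) x))"
  note transpose = AE_transpose_in_arg_max_event_iff[OF assms, folded \<pi>_def]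
  let ?E = "{U\<in>space (iid (V \<times> C)). (\<lambda>p\<in>V \<times> C. U (\<pi> p)) \<in> arg_max_event V C g}"
  have "inj_on \<pi> (V \<times> C)" by (auto simp: inj_on_def \<pi>_def dest: transpose_eq_imp_eq)
  then have "measure (iid (V \<times> C)) (arg_max_event V C g) = measure (iid (V \<times> C)) ?E"
    using assms(1,2) transpose(1) by (intro prob_iid_reindex[symmetric] sets_arg_max_event)
  also have "\<dots> = measure (iid (V \<times> C)) (arg_max_event V C h)"
  proof (rule P.finite_measure_eq_AE)
    show "AE U in iid (V \<times> C). U \<in> ?E \<longleftrightarrow> U \<in> arg_max_event V C h"
      using transpose(2) AE_space by eventually_elim simp
    show "?E \<in> sets (iid (V \<times> C))"
      using assms(1,2) transpose(1) by (intro sets_iid_reindex sets_arg_max_event)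
  qed (intro sets_arg_max_event assms)
  finally show ?thesis .
qed

lemma disjoint_family_arg_max_event: "disjoint_family_on (arg_max_event V C) (V \<rightarrow>\<^sub>E C)"
  unfolding disjoint_family_on_def
proof (intro ballI impI equals0I)
  fix f f' U assume f: "f \<in> V \<rightarrow>\<^sub>E C" "f' \<in> V \<rightarrow>\<^sub>E C" "f \<noteq> f'"
    and "U \<in> arg_max_event V C f \<inter> arg_max_event V C f'"
  then have "f v = f' v" if "v \<in> V" for v using that by (auto simp: arg_max_event_def)
  then have "f = f'" by (rule PiE_ext[OF f(1,2)])
  with f(3) show False ..
qed

lemma prob_arg_max_event:
  assumes "finite V" "finite C" and h: "h \<in> V \<rightarrow> C"
  shows "measure (iid (V \<times> C)) (arg_max_event V C h) = 1 / real (card C) ^ card V"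
proof (cases "V = {}")
  case True
  then have "arg_max_event V C h = space (iid (V \<times> C))" by (simp add: arg_max_event_def)
  then show ?thesis using True prob_space.prob_space[OF prob_space_iid] by simp
next
  case False
  then have "C \<noteq> {}" using h by auto
  interpret P: prob_space "iid (V \<times> C)" by (rule prob_space_iid)
  let ?H = "V \<rightarrow>\<^sub>E C"
  have space: "space (iid (V \<times> C)) = (\<Union>f\<in>?H. arg_max_event V C f)"
  proof (intro equalityI subsetI)
    fix U assume "U \<in> space (iid (V \<times> C))"
    then have "U \<in> arg_max_event V C (\<lambda>v\<in>V. arg_max_on (\<lambda>x. U (v, x)) C)"
      by (simp add: arg_max_event_def)
    moreover have "(\<lambda>v\<in>V. arg_max_on (\<lambda>x. U (v, x)) C) \<in> ?H"
      using arg_max_on_in[OF \<open>finite C\<close> \<open>C \<noteq> {}\<close>] by simp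
    ultimately show "U \<in> (\<Union>f\<in>?H. arg_max_event V C f)" by blast
  qed (auto simp: arg_max_event_def)
  have "1 = P.prob (\<Union>f\<in>?H. arg_max_event V C f)"
    unfolding space[symmetric] by (rule P.prob_space[symmetric])
  also have "\<dots> = (\<Sum>f\<in>?H. P.prob (arg_max_event V C f))"
  proof (rule P.finite_measure_finite_Union)
    show "disjoint_family_on (arg_max_event V C) ?H" by (rule disjoint_family_arg_max_event)
  qed (use assms(1,2) sets_arg_max_event in \<open>auto intro: finite_PiE\<close>)
  also have "\<dots> = (\<Sum>f\<in>?H. P.prob (arg_max_event V C h))"
    using assms by (intro sum.cong refl prob_arg_max_event_cong) auto
  also have "\<dots> = real (card C) ^ card V * P.prob (arg_max_event V C h)"
    using assms(1) by (simp add: card_PiE)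
  finally show ?thesis
    using \<open>C \<noteq> {}\<close> \<open>finite C\<close> by (simp add: field_simps card_gt_0_iff)
qed

lemma prob_iid_arg_max_on_eq:
  assumes "finite V" "finite C" and h: "h \<in> V \<rightarrow> C"
    and cell: "inj_on cell (V \<times> C)" "cell ` (V \<times> C) \<subseteq> I"
  defines "E \<equiv> {U\<in>space (iid I). \<forall>v\<in>V. arg_max_on (\<lambda>x. U (cell (v, x))) C = h v}"
  shows "E \<in> sets (iid I)" and "measure (iid I) E = 1 / real (card C) ^ card V"
proof -
  let ?select = "\<lambda>U. \<lambda>p\<in>V \<times> C. U (cell p)"
  have "arg_max_on (\<lambda>x. ?select U (v, x)) C = arg_max_on (\<lambda>x. U (cell (v, x))) C" if "v \<in> V"
    for U :: "_ \<Rightarrow> real" and v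
    using that by (intro arg_max_on_cong) simp
  then have E_eq: "E = {U\<in>space (iid I). ?select U \<in> arg_max_event V C h}"
    using measurable_space[OF measurable_iid_reindex[OF cell(2)]] by (auto simp: E_def arg_max_event_def)
  note event = sets_arg_max_event[OF assms(1,2), of h]
  show "E \<in> sets (iid I)" unfolding E_eq by (rule sets_iid_reindex[OF cell(2) event])
  show "measure (iid I) E = 1 / real (card C) ^ card V"
    unfolding E_eq prob_iid_reindex[OF cell event] by (rule prob_arg_max_event[OF assms(1-3)])
qed

end

section \<open>The exact cycle probability\<close>

text \<open>A node \<open>(i, a)\<close> stands for player \<open>i\<close> responding to action \<open>a\<close> of the opponent; the responses
  of player \<open>i\<close> to \<open>a\<close> correspond to the cells \<open>resp_cell ((i, a), x)\<close> of the payoff table.\<close>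

definition resp_nodes :: "nat \<Rightarrow> (nat \<times> nat) set" where
  "resp_nodes m = {1, 2} \<times> {1..m}"

definition resp_cell :: "(nat \<times> nat) \<times> nat \<Rightarrow> nat \<times> (nat \<times> nat)" where
  "resp_cell = (\<lambda>((i, a), x). (i, if i = 1 then (x, a) else (a, x)))"

definition best_resp :: "nat \<Rightarrow> payoffs \<Rightarrow> nat \<times> nat \<Rightarrow> nat" where
  "best_resp m U v = arg_max_on (\<lambda>x. U (resp_cell (v, x))) {1..m}"

definition resp_step :: "nat \<Rightarrow> payoffs \<Rightarrow> nat \<times> nat \<Rightarrow> nat \<times> nat" where
  "resp_step m U v = (3 - fst v, best_resp m U v)"

lemma inj_resp_cell: "inj resp_cell"
  by (auto simp: inj_def resp_cell_def split: if_splits)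

lemma resp_cell_in_payoff_index: "resp_cell ` (resp_nodes m \<times> {1..m}) \<subseteq> payoff_index m"
  by (auto simp: resp_cell_def resp_nodes_def payoff_index_def)

lemma best_resp_1: "best_resp m U (1, a) = best_resp1 m U a"
  and best_resp_2: "best_resp m U (2, a) = best_resp2 m U a"
  by (simp_all add: best_resp_def best_resp1_def best_resp2_def resp_cell_def)

lemma best_resp_in: "m \<ge> 1 \<Longrightarrow> best_resp m U v \<in> {1..m}"
  unfolding best_resp_def by (intro arg_max_on_in) auto

lemma clockwork_Suc: "clockwork (Suc t) = (if even t then 1 else 2)"
  by (simp add: clockwork_def even_iff_mod_2_eq_zero)

definition resp_orbit :: "nat \<Rightarrow> payoffs \<Rightarrow> nat \<Rightarrow> nat \<Rightarrow> nat \<times> nat" where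
  "resp_orbit m U a = (\<lambda>t. (resp_step m U ^^ t) (1, a))"

lemma resp_orbit_simps:
  "resp_orbit m U a 0 = (1, a)"
  "resp_orbit m U a (Suc t) = resp_step m U (resp_orbit m U a t)"
  by (simp_all add: resp_orbit_def)

lemma fst_resp_orbit: "fst (resp_orbit m U a t) = clockwork (Suc t)"
  by (induction t) (simp_all add: resp_orbit_simps resp_step_def clockwork_Suc)

lemma snd_resp_orbit_in: "a \<in> {1..m} \<Longrightarrow> snd (resp_orbit m U a t) \<in> {1..m}"
  using best_resp_in[of m] by (cases t) (auto simp: resp_orbit_simps resp_step_def)

lemma snd_resp_orbit_Suc:
  "snd (resp_orbit m U a (Suc t)) =
    (if even t then best_resp1 else best_resp2) m U (snd (resp_orbit m U a t))"
  using fst_resp_orbit[of m U a t] best_resp_1 best_resp_2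
  by (cases "resp_orbit m U a t") (auto simp: resp_orbit_simps resp_step_def clockwork_Suc)

lemma cw_dyn_Suc_eq:
  "cw_dyn m U a0 (Suc t) =
    (let x = snd (resp_orbit m U (snd a0) t);
         y = snd (resp_orbit m U (snd a0) (Suc t))
     in if even t then (y, x) else (x, y))"
proof (induction t)
  case 0
  show ?case by (simp add: snd_resp_orbit_Suc resp_orbit_simps(1) clockwork_def)
next
  case (Suc t)
  show ?case
    by (subst cw_dyn.simps, unfold Suc snd_resp_orbit_Suc[of _ _ _ "Suc t"])
      (simp add: Let_def clockwork_Suc)
qed

lemma cw_dyn_Suc_eq_iff:
  "cw_dyn m U a0 (Suc s) = cw_dyn m U a0 (Suc s + 2 * k) \<longleftrightarrow>
    resp_orbit m U (snd a0) (s + 2 * k) = resp_orbit m U (snd a0) s"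
proof
  assume "cw_dyn m U a0 (Suc s) = cw_dyn m U a0 (Suc s + 2 * k)"
  then have "snd (resp_orbit m U (snd a0) (s + 2 * k)) = snd (resp_orbit m U (snd a0) s)"
    unfolding add_Suc cw_dyn_Suc_eq by (simp add: Let_def split: if_splits)
  then show "resp_orbit m U (snd a0) (s + 2 * k) = resp_orbit m U (snd a0) s"
    by (simp add: prod_eq_iff fst_resp_orbit clockwork_Suc)
next
  assume "resp_orbit m U (snd a0) (s + 2 * k) = resp_orbit m U (snd a0) s"
  then show "cw_dyn m U a0 (Suc s) = cw_dyn m U a0 (Suc s + 2 * k)"
    unfolding add_Suc cw_dyn_Suc_eq by (simp add: resp_orbit_simps)
qed

lemma converges_to_cycle_iff_rho_path:
  assumes "k \<ge> 1"
  shows "converges_to_cycle m U a0 k \<longleftrightarrow>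
    (\<exists>vs. rho_path (resp_step m U) (2 * k) vs \<and> hd vs = (1, snd a0))"
proof -
  let ?z = "resp_orbit m U (snd a0)"
  have odd: "?z (s + q) \<noteq> ?z s" if "odd q" for s q
  proof -
    have "fst (?z (s + q)) \<noteq> fst (?z s)" using that by (simp add: fst_resp_orbit clockwork_Suc)
    then show ?thesis by force
  qed
  have even_periods: "(\<forall>k'. 1 \<le> k' \<and> k' < k \<longrightarrow> ?z (s + 2 * k') \<noteq> ?z s) \<longleftrightarrow>
      (\<forall>q. 1 \<le> q \<and> q < 2 * k \<longrightarrow> ?z (s + q) \<noteq> ?z s)" (is "?E \<longleftrightarrow> ?A") for s
  proof
    assume ?E
    show ?A
    proof (intro allI impI)
      fix q assume "1 \<le> q \<and> q < 2 * k"
      with \<open>?E\<close> odd show "?z (s + q) \<noteq> ?z s" by (cases "even q") (auto elim!: evenE)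
    qed
  qed auto
  have "(\<exists>\<tau>\<ge>1. P \<tau>) \<longleftrightarrow> (\<exists>s. P (Suc s))" for P :: "nat \<Rightarrow> bool"
    by (auto simp: Suc_le_eq gr0_conv_Suc)
  then have "converges_to_cycle m U a0 k \<longleftrightarrow>
      (\<exists>s. ?z (s + 2 * k) = ?z s \<and> (\<forall>q. 1 \<le> q \<and> q < 2 * k \<longrightarrow> ?z (s + q) \<noteq> ?z s))"
    unfolding converges_to_cycle_def even_periods[symmetric] by (simp only: cw_dyn_Suc_eq_iff)
  also have "\<dots> \<longleftrightarrow> (\<exists>s. ?z (s + 2 * k) = ?z s \<and> inj_on ?z {..<s + 2 * k})"
    unfolding resp_orbit_def using assms by (intro funpow_period_iff_inj_on) simp
  also have "\<dots> \<longleftrightarrow> (\<exists>vs. rho_path (resp_step m U) (2 * k) vs \<and> hd vs = (1, snd a0))"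
    unfolding resp_orbit_def using assms by (intro ex_rho_path_iff[symmetric]) simp
  finally show ?thesis .
qed

definition alt_paths :: "nat \<Rightarrow> nat \<Rightarrow> (nat \<times> nat) list set" where
  "alt_paths m = distinct_lists_in (\<lambda>j. {clockwork (Suc j)} \<times> {1..m})"

lemma finite_alt_paths: "finite (alt_paths m T)"
  unfolding alt_paths_def by (intro finite_distinct_lists_in) auto

lemma card_alt_paths: "card (alt_paths m T) = (\<Prod>j<T. m - j div 2)"
proof -
  let ?B = "\<lambda>j. {clockwork (Suc j)} \<times> {1..m}"
  have "card (alt_paths m T) = (\<Prod>j<T. card (?B j) - card {i. i < j \<and> ?B i = ?B j})"
    unfolding alt_paths_def by (intro card_distinct_lists_in) auto
  also have "\<dots> = (\<Prod>j<T. m - j div 2)"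
  proof (rule prod.cong)
    fix j
    have "?B i = ?B j \<longleftrightarrow> even i = even j" if "m > 0" for i
      using that by (auto simp: clockwork_Suc times_eq_iff)
    then show "card (?B j) - card {i. i < j \<and> ?B i = ?B j} = m - j div 2"
      by (cases "m = 0") (simp_all add: card_same_parity_less)
  qed simp
  finally show ?thesis .
qed

lemma alt_pathsD:
  assumes "vs \<in> alt_paths m T"
  shows "length vs = T" "distinct vs" "set vs \<subseteq> resp_nodes m"
    and "\<And>j. j < T \<Longrightarrow> fst (vs ! j) = clockwork (Suc j)"
proof -
  show "length vs = T" "distinct vs" using assms by (simp_all add: alt_paths_def distinct_lists_in_def)
  have nth: "vs ! j \<in> {clockwork (Suc j)} \<times> {1..m}" if "j < T" for j
    using assms that by (simp add: alt_paths_def distinct_lists_in_def)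
  then show "fst (vs ! j) = clockwork (Suc j)" if "j < T" for j using that by (auto simp: mem_Times_iff)
  show "set vs \<subseteq> resp_nodes m"
  proof
    fix v assume "v \<in> set vs"
    then obtain j where "j < T" "v = vs ! j" using \<open>length vs = T\<close> by (auto simp: in_set_conv_nth)
    then show "v \<in> resp_nodes m"
      using nth[of j] by (auto simp: resp_nodes_def clockwork_Suc split: if_splits)
  qed
qed

lemma rho_path_in_alt_paths:
  assumes "rho_path (resp_step m U) p vs" "hd vs = (1, a)" "a \<in> {1..m}"
  shows "vs \<in> alt_paths m (length vs)"
proof -
  have "vs ! j \<in> {clockwork (Suc j)} \<times> {1..m}" if "j < length vs" for j
    using rho_path_nth[OF assms(1) that] fst_resp_orbit[of m U a j] snd_resp_orbit_in[OF assms(3), of U j]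
    by (simp add: assms(2) mem_Times_iff resp_orbit_def)
  then show ?thesis using assms(1) by (simp add: alt_paths_def distinct_lists_in_def rho_path_def)
qed

lemma alt_paths_eq_empty:
  assumes "2 * m < T"
  shows "alt_paths m T = {}"
proof -
  have "(\<Prod>j<T. m - j div 2) = 0"
    using assms by (intro prod_zero) (auto intro!: bexI[of _ "2 * m"])
  then show ?thesis using finite_alt_paths by (simp flip: card_alt_paths)
qed

lemma rho_path_alt_path_iff:
  assumes "vs \<in> alt_paths m T" "k \<ge> 1" "2 * k \<le> T"
  shows "rho_path (resp_step m U) (2 * k) vs \<longleftrightarrow>
    map (best_resp m U) vs = map snd (tl vs @ [vs ! (T - 2 * k)])"
proof -
  note vs = alt_pathsD[OF assms(1)]
  let ?ws = "tl vs @ [vs ! (T - 2 * k)]"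
  have "map (\<lambda>v. 3 - fst v) vs = map fst ?ws"
  proof (rule nth_equalityI)
    fix j assume "j < length (map (\<lambda>v. 3 - fst v) vs)"
    then have j: "j < T" using vs(1) by simp
    then consider "Suc j < T" | "T = Suc j" by linarith
    then show "map (\<lambda>v. 3 - fst v) vs ! j = map fst ?ws ! j"
      using assms(2,3) j vs(1) by cases (auto simp: nth_append nth_tl vs(4) clockwork_Suc)
  qed (use vs(1) assms in simp)
  moreover have "map (resp_step m U) vs = zip (map (\<lambda>v. 3 - fst v) vs) (map (best_resp m U) vs)"
    by (simp add: zip_map_map zip_same_conv_map resp_step_def)
  ultimately have "map (resp_step m U) vs = ?ws \<longleftrightarrow> map (best_resp m U) vs = map snd ?ws"
    by (metis length_map map_snd_zip zip_map_fst_snd)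
  then show ?thesis using assms(2,3) vs(1,2) by (simp add: rho_path_def)
qed

text \<open>The probability that the first \<open>T\<close> nodes of the orbit are distinct: the player moving at step
  \<open>j\<close> has to avoid the \<open>j div 2\<close> nodes of the same player visited before.\<close>

definition birthday_prod :: "nat \<Rightarrow> nat \<Rightarrow> real" where
  "birthday_prod m T = (\<Prod>j<T. 1 - real (j div 2) / real m)"

definition birthday_tail :: "nat \<Rightarrow> nat \<Rightarrow> real" where
  "birthday_tail m a = (\<Sum>t=a..<2 * m. birthday_prod m (Suc t))"

lemma card_alt_paths_div:
  assumes "m \<ge> 1" "T \<le> 2 * m"
  shows "real (card (alt_paths m T)) / real m ^ T = birthday_prod m T"
proof -
  have "birthday_prod m T = (\<Prod>j<T. real (m - j div 2) / real m)"
    unfolding birthday_prod_def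
  proof (rule prod.cong)
    fix j assume "j \<in> {..<T}"
    then have "j div 2 \<le> m" using assms(2) by auto
    then show "1 - real (j div 2) / real m = real (m - j div 2) / real m"
      using assms(1) by (simp add: field_simps)
  qed simp
  then show ?thesis by (simp add: prod_dividef card_alt_paths)
qed

lemma ex_map_eq:
  assumes "distinct vs" "length xs = length vs"
  obtains h where "map h vs = xs"
proof
  show "map (the \<circ> map_of (zip vs xs)) vs = xs"
    using assms by (intro nth_equalityI) (simp_all add: map_of_zip_nth)
qed

context atomless_distribution
begin

lemma prob_map_best_resp_eq:
  fixes m :: nat
  assumes vs: "distinct vs" "set vs \<subseteq> resp_nodes m"
    and xs: "length xs = length vs" "set xs \<subseteq> {1..m}"
  defines "E \<equiv> {U\<in>space (iid (payoff_index m)). map (best_resp m U) vs = xs}"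
  shows "E \<in> sets (iid (payoff_index m))"
    and "measure (iid (payoff_index m)) E = 1 / real m ^ length vs"
proof -
  obtain h where h: "map h vs = xs" using ex_map_eq[OF vs(1) xs(1)] .
  have E_eq: "E = {U\<in>space (iid (payoff_index m)).
      \<forall>v\<in>set vs. arg_max_on (\<lambda>x. U (resp_cell (v, x))) {1..m} = h v}"
    unfolding E_def h[symmetric] by (simp add: best_resp_def)
  have "h \<in> set vs \<rightarrow> {1..m}" using xs(2) h by auto
  moreover have "inj_on resp_cell (set vs \<times> {1..m})" using inj_resp_cell by (rule inj_on_subset) simp
  moreover have "resp_cell ` (set vs \<times> {1..m}) \<subseteq> payoff_index m"
    using resp_cell_in_payoff_index[of m] vs(2) by blast
  ultimately have law: "E \<in> sets (iid (payoff_index m))"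
    "measure (iid (payoff_index m)) E = 1 / real (card {1..m}) ^ card (set vs)"
    unfolding E_eq by (rule prob_iid_arg_max_on_eq[OF finite_set finite_atLeastAtMost])+
  show "E \<in> sets (iid (payoff_index m))" by (fact law(1))
  show "measure (iid (payoff_index m)) E = 1 / real m ^ length vs"
    using law(2) by (simp add: distinct_card[OF vs(1)])
qed

lemma prob_rho_path:
  assumes vs: "vs \<in> alt_paths m T" and k: "k \<ge> 1" "2 * k \<le> T"
  defines "E \<equiv> {U\<in>space (iid (payoff_index m)). rho_path (resp_step m U) (2 * k) vs}"
  shows "E \<in> sets (iid (payoff_index m))" and "measure (iid (payoff_index m)) E = 1 / real m ^ T"
proof -
  note path = alt_pathsD[OF vs]
  let ?ws = "tl vs @ [vs ! (T - 2 * k)]"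
  have "set ?ws \<subseteq> set vs" using path(1) k by (auto dest: list.set_sel(2)[rotated])
  then have "set (map snd ?ws) \<subseteq> {1..m}" using path(3) by (fastforce simp: resp_nodes_def)
  moreover have "length (map snd ?ws) = length vs" using path(1) k by simp
  ultimately show "E \<in> sets (iid (payoff_index m))" and "measure (iid (payoff_index m)) E = 1 / real m ^ T"
    unfolding E_def rho_path_alt_path_iff[OF vs k]
    using prob_map_best_resp_eq[OF path(2,3)] path(1) by blast+
qed

definition rho_event :: "nat \<Rightarrow> nat \<Rightarrow> (nat \<times> nat) list \<Rightarrow> (payoffs \<times> profile) set" where
  "rho_event m k vs = {\<omega>\<in>space (game_space D m).
     rho_path (resp_step m (fst \<omega>)) (2 * k) vs \<and> hd vs = (1, snd (snd \<omega>))}"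

lemma space_game_space:
  "space (game_space D m) = space (iid (payoff_index m)) \<times> ({1..m} \<times> {1..m})"
  by (simp add: game_space_def space_pair_measure space_uniform_count_measure)

lemma prob_rho_event:
  assumes vs: "vs \<in> alt_paths m T" and k: "k \<ge> 1" "2 * k \<le> T"
  shows "rho_event m k vs \<in> sets (game_space D m)"
    and "measure (game_space D m) (rho_event m k vs) = 1 / real m ^ Suc T"
proof -
  let ?M = "iid (payoff_index m)" and ?N = "uniform_count_measure ({1..m} \<times> {1..m})"
  let ?E = "{U\<in>space ?M. rho_path (resp_step m U) (2 * k) vs}" and ?F = "{1..m} \<times> {snd (hd vs)}"
  have "vs \<noteq> []" using alt_pathsD(1)[OF vs] k by auto
  then have "hd vs \<in> set vs" "hd vs = vs ! 0" by (simp_all add: hd_conv_nth)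
  then have hd: "fst (hd vs) = 1" "snd (hd vs) \<in> {1..m}"
    using alt_pathsD(3)[OF vs] alt_pathsD(4)[OF vs, of 0] k by (auto simp: resp_nodes_def clockwork_Suc)
  then have m: "m \<ge> 1" by simp
  interpret M: prob_space ?M by (rule prob_space_iid)
  interpret N: prob_space ?N using m by (intro prob_space_uniform_count_measure) auto
  have rho_event_eq: "rho_event m k vs = ?E \<times> ?F"
    unfolding rho_event_def space_game_space using hd by (auto simp: prod_eq_iff)
  have E: "?E \<in> sets ?M" "measure ?M ?E = 1 / real m ^ T" using prob_rho_path[OF assms] by auto
  have F: "?F \<in> sets ?N" using hd(2) by (auto simp: sets_uniform_count_measure)
  show "rho_event m k vs \<in> sets (game_space D m)"
    unfolding rho_event_eq game_space_def using E(1) F by (rule pair_measureI)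
  have "measure ?N ?F = 1 / real m"
    using hd(2) m by (subst measure_uniform_count_measure) (auto simp: card_cartesian_product)
  then have "measure (?M \<Otimes>\<^sub>M ?N) (?E \<times> ?F) = 1 / real m ^ T * (1 / real m)"
    using N.emeasure_pair_measure_Times[OF E(1) F] E(2) by (simp add: measure_def enn2real_mult)
  then show "measure (game_space D m) (rho_event m k vs) = 1 / real m ^ Suc T"
    by (simp add: rho_event_eq game_space_def mult.commute)
qed

lemma cycle_event_eq_UN:
  assumes "k \<ge> 1"
  shows "{\<omega>\<in>space (game_space D m). converges_to_cycle m (fst \<omega>) (snd \<omega>) k} =
    (\<Union>vs\<in>(\<Union>T\<in>{2 * k..2 * m}. alt_paths m T). rho_event m k vs)" (is "?C = ?R")
proof (intro equalityI subsetI)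
  fix \<omega> assume "\<omega> \<in> ?C"
  then obtain vs where \<omega>: "\<omega> \<in> rho_event m k vs"
    unfolding converges_to_cycle_iff_rho_path[OF assms] rho_event_def by blast
  then have vs: "rho_path (resp_step m (fst \<omega>)) (2 * k) vs" "hd vs = (1, snd (snd \<omega>))"
    and "snd (snd \<omega>) \<in> {1..m}"
    by (auto simp: rho_event_def space_game_space)
  then have path: "vs \<in> alt_paths m (length vs)" by (rule rho_path_in_alt_paths)
  moreover have "2 * k \<le> length vs" using vs(1) by (simp add: rho_path_def)
  moreover have "length vs \<le> 2 * m" using path alt_paths_eq_empty[of m "length vs"] by force
  ultimately show "\<omega> \<in> ?R" using \<omega> by auto
next
  fix \<omega> assume "\<omega> \<in> ?R"
  then show "\<omega> \<in> ?C"
    unfolding converges_to_cycle_iff_rho_path[OF assms] rho_event_def by blast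
qed

theorem cycle_prob_eq:
  assumes m: "m \<ge> 1" and k: "k \<ge> 1"
  shows "cycle_prob D m k = birthday_tail m (2 * k - 1) / real m"
proof -
  let ?M = "iid (payoff_index m)" and ?N = "uniform_count_measure ({1..m} \<times> {1..m})"
  let ?G = "game_space D m" and ?X = "\<Union>T\<in>{2 * k..2 * m}. alt_paths m T"
  interpret M: prob_space ?M by (rule prob_space_iid)
  interpret N: prob_space ?N using m by (intro prob_space_uniform_count_measure) auto
  interpret G: pair_prob_space ?M ?N ..
  have "cycle_prob D m k = measure ?G (\<Union>vs\<in>?X. rho_event m k vs)"
    by (simp only: cycle_prob_def cycle_event_eq_UN[OF k])
  also have "\<dots> = (\<Sum>vs\<in>?X. measure ?G (rho_event m k vs))"
    unfolding game_space_def
  proof (rule G.finite_measure_finite_Union)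
    show "finite ?X" using finite_alt_paths by blast
    show "rho_event m k ` ?X \<subseteq> sets (?M \<Otimes>\<^sub>M ?N)"
      using prob_rho_event(1) k by (auto simp: game_space_def)
    show "disjoint_family_on (rho_event m k) ?X"
      by (auto simp: disjoint_family_on_def rho_event_def dest: rho_path_unique)
  qed
  also have "\<dots> = (\<Sum>T=2*k..2*m. \<Sum>vs\<in>alt_paths m T. measure ?G (rho_event m k vs))"
    by (intro sum.UNION_disjoint) (auto simp: finite_alt_paths dest: alt_pathsD(1))
  also have "\<dots> = (\<Sum>T=2*k..2*m. birthday_prod m T / real m)"
  proof (rule sum.cong)
    fix T assume T: "T \<in> {2*k..2*m}"
    then have "(\<Sum>vs\<in>alt_paths m T. measure ?G (rho_event m k vs)) = (\<Sum>vs\<in>alt_paths m T. 1 / real m ^ Suc T)"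
      using k by (intro sum.cong prob_rho_event) auto
    also have "\<dots> = birthday_prod m T / real m"
      using T m by (simp flip: card_alt_paths_div)
    finally show "(\<Sum>vs\<in>alt_paths m T. measure ?G (rho_event m k vs)) = birthday_prod m T / real m" .
  qed simp
  also have "\<dots> = (\<Sum>T\<in>{Suc (2 * k - 1)..<Suc (2 * m)}. birthday_prod m T) / real m"
    using k by (simp add: atLeastLessThanSuc_atLeastAtMost sum_divide_distrib)
  also have "\<dots> = birthday_tail m (2 * k - 1) / real m"
    unfolding birthday_tail_def by (simp only: sum.shift_bounds_Suc_ivl)
  finally show ?thesis .
qed

end

section \<open>Gaussian asymptotics\<close>

definition gauss_weight :: "real \<Rightarrow> real \<Rightarrow> real" where
  "gauss_weight m x = exp (- x\<^sup>2 / (4 * m))"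

lemma gauss_weight_pos: "gauss_weight m x > 0"
  by (simp add: gauss_weight_def)

lemma gauss_weight_antimono:
  assumes "m > 0" "0 \<le> x" "x \<le> y"
  shows "gauss_weight m y \<le> gauss_weight m x"
  using assms by (simp add: gauss_weight_def divide_right_mono power_mono)

text \<open>The tail integral of \<open>gauss_weight m\<close> over \<open>y \<ge> x\<close>, after the substitution
  \<open>y = z * sqrt (2 * m)\<close>.\<close>

definition gauss_tail :: "real \<Rightarrow> real \<Rightarrow> real" where
  "gauss_tail m x = 2 * sqrt (pi * m) * (1 - Phi (x / sqrt (2 * m)))"

lemma gauss_tail_pos: "m > 0 \<Longrightarrow> gauss_tail m x > 0"
  using Phi_less_1[of "x / sqrt (2 * m)"] by (simp add: gauss_tail_def)

lemma DERIV_gauss_tail: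
  assumes "m > 0"
  shows "(gauss_tail m has_real_derivative - gauss_weight m x) (at x)"
proof -
  have "((\<lambda>x. Phi (x / sqrt (2 * m))) has_real_derivative
      std_normal_density (x / sqrt (2 * m)) * (1 / sqrt (2 * m))) (at x)"
    by (intro DERIV_chain2[OF DERIV_Phi] DERIV_cdivide DERIV_ident)
  then have "(gauss_tail m has_real_derivative
      2 * sqrt (pi * m) * (0 - std_normal_density (x / sqrt (2 * m)) * (1 / sqrt (2 * m)))) (at x)"
    unfolding gauss_tail_def[abs_def] by (intro DERIV_cmult DERIV_diff DERIV_const)
  moreover have "2 * sqrt (pi * m) * (0 - std_normal_density (x / sqrt (2 * m)) * (1 / sqrt (2 * m))) =
      - gauss_weight m x"
    using assms
    by (simp add: gauss_weight_def std_normal_density_def power_divide real_sqrt_mult field_simps)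
  ultimately show ?thesis by simp
qed

lemma gauss_tail_mvt:
  assumes "m > 0" "d \<ge> 0"
  obtains y where "x \<le> y" "y \<le> x + d" "gauss_tail m x - gauss_tail m (x + d) = d * gauss_weight m y"
proof (cases "d = 0")
  case False
  then have "x < x + d" using assms by simp
  then obtain y where "x < y" "y < x + d"
    "gauss_tail m (x + d) - gauss_tail m x = (x + d - x) * - gauss_weight m y"
    using MVT2[OF _ DERIV_gauss_tail[OF assms(1)]] by blast
  then show ?thesis by (intro that[of y]) simp_all
qed (simp add: that[of x])

lemma gauss_tail_diff_bounds:
  assumes "m > 0" "x \<ge> 0" "d \<ge> 0"
  shows "d * gauss_weight m (x + d) \<le> gauss_tail m x - gauss_tail m (x + d)"
    and "gauss_tail m x - gauss_tail m (x + d) \<le> d * gauss_weight m x"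
proof -
  obtain y where "x \<le> y" "y \<le> x + d"
    "gauss_tail m x - gauss_tail m (x + d) = d * gauss_weight m y"
    using assms by (elim gauss_tail_mvt)
  then show "d * gauss_weight m (x + d) \<le> gauss_tail m x - gauss_tail m (x + d)"
    and "gauss_tail m x - gauss_tail m (x + d) \<le> d * gauss_weight m x"
    using assms by (simp_all add: gauss_weight_antimono mult_left_mono)
qed

lemma gauss_tail_add_le:
  assumes "m > 0" "x \<ge> 0" "d \<ge> 0"
  shows "gauss_tail m (x + d) \<le> gauss_weight m d * gauss_tail m x"
proof -
  have "1 - Phi ((x + d) / sqrt (2 * m)) \<le> gauss_weight m d * (1 - Phi (x / sqrt (2 * m)))"
    using one_minus_Phi_add_le[of "x / sqrt (2 * m)" "d / sqrt (2 * m)"] assms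
    by (simp add: gauss_weight_def power_divide add_divide_distrib)
  then have "2 * sqrt (pi * m) * (1 - Phi ((x + d) / sqrt (2 * m)))
      \<le> 2 * sqrt (pi * m) * (gauss_weight m d * (1 - Phi (x / sqrt (2 * m))))"
    by (rule mult_left_mono) (use assms in simp)
  then show ?thesis by (simp add: gauss_tail_def mult_ac)
qed

lemma gauss_weight_le_gauss_tail:
  assumes "m > 0" "x \<ge> 0" "d > 0"
  shows "gauss_weight m x \<le> exp ((2 * x * d + d\<^sup>2) / (4 * m)) / d * gauss_tail m x"
proof -
  have "gauss_weight m x = exp ((2 * x * d + d\<^sup>2) / (4 * m)) * gauss_weight m (x + d)"
    unfolding gauss_weight_def exp_add[symmetric]
    by (simp add: power2_sum diff_divide_distrib add_divide_distrib)
  also have "\<dots> = exp ((2 * x * d + d\<^sup>2) / (4 * m)) / d * (d * gauss_weight m (x + d))"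
    using assms by simp
  also have "\<dots> \<le> exp ((2 * x * d + d\<^sup>2) / (4 * m)) / d * gauss_tail m x"
    using gauss_tail_diff_bounds(1)[of m x d] gauss_tail_pos[of m "x + d"] assms
    by (intro mult_left_mono) auto
  finally show ?thesis .
qed

lemma gauss_tail_diff_le_sum:
  assumes "m > 0" "a \<le> b"
  shows "gauss_tail m (real a) - gauss_tail m (real b) \<le> (\<Sum>t=a..<b. gauss_weight m (real t))"
proof -
  have "gauss_tail m (real a) - gauss_tail m (real b) =
      (\<Sum>t=a..<b. gauss_tail m (real t) - gauss_tail m (real t + 1))"
    using sum_Suc_diff'[of a b "\<lambda>t. - gauss_tail m (real t)"] assms(2) by (simp add: algebra_simps)
  also have "\<dots> \<le> (\<Sum>t=a..<b. gauss_weight m (real t))"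
    using gauss_tail_diff_bounds(2)[OF assms(1), of "real _" 1] by (intro sum_mono) simp
  finally show ?thesis .
qed

lemma sum_le_gauss_tail:
  assumes "m > 0"
  shows "(\<Sum>t=a..<b. gauss_weight m (real t)) \<le> gauss_weight m (real a) + gauss_tail m (real a)"
proof (cases "a < b")
  case True
  have "(\<Sum>t=a..<b. gauss_weight m (real t)) =
      gauss_weight m (real a) + (\<Sum>t=Suc a..<b. gauss_weight m (real t))"
    using True by (rule sum.atLeast_Suc_lessThan)
  also have "(\<Sum>t=Suc a..<b. gauss_weight m (real t)) = (\<Sum>t=a..<b - 1. gauss_weight m (real t + 1))"
    using True sum.shift_bounds_Suc_ivl[of "\<lambda>t. gauss_weight m (real t)" a "b - 1"]
    by (simp add: add.commute)
  also have "\<dots> \<le> (\<Sum>t=a..<b - 1. gauss_tail m (real t) - gauss_tail m (real t + 1))"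
    using gauss_tail_diff_bounds(1)[OF assms, of "real _" 1] by (intro sum_mono) simp
  also have "\<dots> = gauss_tail m (real a) - gauss_tail m (real (b - 1))"
    using sum_Suc_diff'[of a "b - 1" "\<lambda>t. - gauss_tail m (real t)"] True by (simp add: algebra_simps)
  also have "\<dots> \<le> gauss_tail m (real a)"
    using gauss_tail_pos[OF assms] by (simp add: less_imp_le)
  finally show ?thesis by simp
qed (use gauss_tail_pos[OF assms] gauss_weight_pos in \<open>simp add: add_nonneg_nonneg less_imp_le\<close>)

lemma gauss_tail_asymp_equiv:
  assumes "x \<in> o(\<lambda>m. sqrt (real m))"
  shows "(\<lambda>m. gauss_tail (real m) (x m)) \<sim>[at_top] (\<lambda>m. sqrt (pi * real m))"
proof -
  have "(\<lambda>m. x m / sqrt (real m) / sqrt 2) \<longlonglongrightarrow> 0 / sqrt 2"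
    by (intro tendsto_intros smalloD_tendsto[OF assms]) simp
  then have "(\<lambda>m. x m / sqrt (2 * real m)) \<longlonglongrightarrow> 0"
    by (simp add: real_sqrt_mult mult.commute)
  then have "(\<lambda>m. Phi (x m / sqrt (2 * real m))) \<longlonglongrightarrow> Phi 0"
    by (rule isCont_tendsto_compose[OF isCont_Phi])
  moreover have "Phi 0 = 1 / 2" using Phi_minus[of 0] by simp
  ultimately have "(\<lambda>m. 2 * (1 - Phi (x m / sqrt (2 * real m)))) \<longlonglongrightarrow> 2 * (1 - 1 / 2)"
    by (intro tendsto_intros) simp
  then have "(\<lambda>m. 2 * (1 - Phi (x m / sqrt (2 * real m)))) \<sim>[at_top] (\<lambda>_. 1)"
    by (simp add: tendsto_imp_asymp_equiv_const)
  from asymp_equiv_mult[OF this asymp_equiv_refl[of "\<lambda>m. sqrt (pi * real m)"]] show ?thesis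
    unfolding gauss_tail_def by (simp only: mult_1 mult.assoc mult.commute[of "sqrt _"])
qed

lemma prod_one_minus_le_exp:
  fixes f :: "'a \<Rightarrow> real"
  assumes "finite A" "\<And>x. x \<in> A \<Longrightarrow> f x \<le> 1"
  shows "(\<Prod>x\<in>A. 1 - f x) \<le> exp (- sum f A)"
proof -
  have "(\<Prod>x\<in>A. 1 - f x) \<le> (\<Prod>x\<in>A. exp (- f x))"
    using assms(2) exp_ge_add_one_self[of "- f _"] by (intro prod_mono) auto
  then show ?thesis using assms(1) by (simp add: exp_sum flip: sum_negf)
qed

lemma prod_one_minus_ge_exp:
  fixes f :: "'a \<Rightarrow> real"
  assumes "finite A" and f: "\<And>x. x \<in> A \<Longrightarrow> 0 \<le> f x \<and> f x \<le> 1 / 2"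
  shows "exp (- sum f A - 2 * (\<Sum>x\<in>A. (f x)\<^sup>2)) \<le> (\<Prod>x\<in>A. 1 - f x)"
proof -
  have "exp (- f x - 2 * (f x)\<^sup>2) \<le> 1 - f x" if "x \<in> A" for x
    using ln_one_minus_pos_lower_bound[of "f x"] f[OF that] by (subst ln_ge_iff[symmetric]) auto
  then have "(\<Prod>x\<in>A. exp (- f x - 2 * (f x)\<^sup>2)) \<le> (\<Prod>x\<in>A. 1 - f x)"
    by (intro prod_mono) auto
  moreover have "(\<Prod>x\<in>A. exp (- f x - 2 * (f x)\<^sup>2)) = exp (- sum f A - 2 * (\<Sum>x\<in>A. (f x)\<^sup>2))"
    using assms(1) by (simp add: sum_subtractf sum_negf sum_distrib_left flip: exp_sum)
  ultimately show ?thesis by simp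
qed

lemma sum_div_2: "4 * (\<Sum>j<Suc t. j div 2) + t mod 2 = t\<^sup>2"
proof (induction t)
  case (Suc t)
  have "4 * (Suc t div 2) + Suc t mod 2 = 2 * t + 1 + t mod 2"
    by (cases "even t") (auto elim!: evenE oddE)
  with Suc show ?case by (simp add: power2_eq_square)
qed simp

lemma sum_div_2_bounds:
  "((real t)\<^sup>2 - 1) / 4 \<le> (\<Sum>j<Suc t. real (j div 2))"
  "(\<Sum>j<Suc t. real (j div 2)) \<le> (real t)\<^sup>2 / 4"
proof -
  have "real (4 * (\<Sum>j<Suc t. j div 2) + t mod 2) = real (t\<^sup>2)"
    by (simp only: sum_div_2)
  then have "4 * (\<Sum>j<Suc t. real (j div 2)) + real (t mod 2) = (real t)\<^sup>2"
    by (simp del: sum.lessThan_Suc)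
  moreover have "real (t mod 2) \<le> 1" by simp
  ultimately show "((real t)\<^sup>2 - 1) / 4 \<le> (\<Sum>j<Suc t. real (j div 2))"
    and "(\<Sum>j<Suc t. real (j div 2)) \<le> (real t)\<^sup>2 / 4" by (simp_all del: sum.lessThan_Suc)
qed

lemma div_2_divide_le_1: "j \<le> 2 * m \<Longrightarrow> real (j div 2) / real m \<le> 1"
  by (auto simp: divide_le_eq_1)

lemma birthday_prod_nonneg:
  assumes "T \<le> 2 * m"
  shows "0 \<le> birthday_prod m T"
  unfolding birthday_prod_def
proof (rule prod_nonneg)
  fix j assume "j \<in> {..<T}"
  then show "0 \<le> 1 - real (j div 2) / real m" using assms div_2_divide_le_1[of j m] by simp
qed

lemma birthday_prod_le:
  assumes "t < 2 * m"
  shows "birthday_prod m (Suc t) \<le> exp (1 / (4 * real m)) * gauss_weight (real m) (real t)"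
proof -
  let ?f = "\<lambda>j. real (j div 2) / real m"
  have "?f j \<le> 1" if "j \<in> {..<Suc t}" for j
    using that assms by (intro div_2_divide_le_1) simp
  then have "birthday_prod m (Suc t) \<le> exp (- (\<Sum>j<Suc t. ?f j))"
    unfolding birthday_prod_def by (rule prod_one_minus_le_exp[OF finite_lessThan])
  also have "\<dots> \<le> exp (1 / (4 * real m) + - (real t)\<^sup>2 / (4 * real m))"
  proof -
    have "((real t)\<^sup>2 - 1) / 4 / real m \<le> (\<Sum>j<Suc t. ?f j)"
      unfolding sum_divide_distrib[symmetric] by (intro divide_right_mono sum_div_2_bounds) simp
    then show ?thesis by (simp add: diff_divide_distrib)
  qed
  finally show ?thesis by (simp only: exp_add gauss_weight_def)
qed

lemma birthday_prod_ge:
  assumes "t < N" "N \<le> m"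
  shows "exp (- (real N ^ 3 / (real m)\<^sup>2)) * gauss_weight (real m) (real t) \<le> birthday_prod m (Suc t)"
proof -
  let ?f = "\<lambda>j. real (j div 2) / real m"
  have m: "real m > 0" using assms by simp
  have f: "0 \<le> ?f j" "?f j \<le> real N / (2 * real m)" "?f j \<le> 1 / 2" if "j \<in> {..<Suc t}" for j
  proof -
    have "2 * real (j div 2) \<le> real N" "2 * real (j div 2) \<le> real m" using that assms by auto
    then show "0 \<le> ?f j" "?f j \<le> real N / (2 * real m)" "?f j \<le> 1 / 2" using m by (auto simp: field_simps)
  qed
  have "2 * (\<Sum>j<Suc t. (?f j)\<^sup>2) \<le> 2 * (\<Sum>j<Suc t. (real N / (2 * real m))\<^sup>2)"
    using f by (intro mult_left_mono sum_mono power_mono) auto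
  also have "\<dots> = real (Suc t) * (real N)\<^sup>2 / (2 * (real m)\<^sup>2)"
    by (simp add: power_divide power_mult_distrib)
  also have "\<dots> \<le> real N * (real N)\<^sup>2 / (real m)\<^sup>2"
    using assms m by (intro frac_le mult_right_mono) auto
  finally have "2 * (\<Sum>j<Suc t. (?f j)\<^sup>2) \<le> real N ^ 3 / (real m)\<^sup>2"
    by (simp add: power3_eq_cube power2_eq_square mult.assoc)
  moreover have "(\<Sum>j<Suc t. ?f j) \<le> (real t)\<^sup>2 / 4 / real m"
    unfolding sum_divide_distrib[symmetric] by (intro divide_right_mono sum_div_2_bounds) simp
  ultimately have "exp (- (real N ^ 3 / (real m)\<^sup>2) + - (real t)\<^sup>2 / (4 * real m))
      \<le> exp (- (\<Sum>j<Suc t. ?f j) - 2 * (\<Sum>j<Suc t. (?f j)\<^sup>2))" by (simp del: sum.lessThan_Suc)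
  also have "\<dots> \<le> birthday_prod m (Suc t)"
    unfolding birthday_prod_def using f(1,3) by (intro prod_one_minus_ge_exp) auto
  finally show ?thesis by (simp only: exp_add gauss_weight_def)
qed

definition birthday_upper_factor :: "nat \<Rightarrow> nat \<Rightarrow> real \<Rightarrow> real" where
  "birthday_upper_factor m a d =
    exp (1 / (4 * real m)) * (1 + exp ((2 * real a * d + d\<^sup>2) / (4 * real m)) / d)"

definition birthday_lower_factor :: "nat \<Rightarrow> nat \<Rightarrow> nat \<Rightarrow> real" where
  "birthday_lower_factor m a h =
    exp (- (real (a + h) ^ 3 / (real m)\<^sup>2)) * (1 - gauss_weight (real m) (real h))"

lemma birthday_tail_le:
  assumes "m \<ge> 1" "d > 0"
  shows "birthday_tail m a \<le> birthday_upper_factor m a d * gauss_tail (real m) (real a)"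
proof -
  have "birthday_tail m a \<le> (\<Sum>t=a..<2 * m. exp (1 / (4 * real m)) * gauss_weight (real m) (real t))"
    unfolding birthday_tail_def by (intro sum_mono birthday_prod_le) auto
  also have "\<dots> = exp (1 / (4 * real m)) * (\<Sum>t=a..<2 * m. gauss_weight (real m) (real t))"
    by (simp only: sum_distrib_left)
  also have "\<dots> \<le> exp (1 / (4 * real m)) *
      (exp ((2 * real a * d + d\<^sup>2) / (4 * real m)) / d * gauss_tail (real m) (real a) +
        gauss_tail (real m) (real a))"
    using sum_le_gauss_tail[of "real m" a "2 * m"] gauss_weight_le_gauss_tail[of "real m" "real a" d] assms
    by (intro mult_left_mono) auto
  finally show ?thesis by (simp add: birthday_upper_factor_def algebra_simps)
qed

lemma birthday_tail_ge:
  assumes "m \<ge> 1" "a + h \<le> m"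
  shows "birthday_lower_factor m a h * gauss_tail (real m) (real a) \<le> birthday_tail m a"
proof -
  let ?e = "exp (- (real (a + h) ^ 3 / (real m)\<^sup>2))"
  have "(1 - gauss_weight (real m) (real h)) * gauss_tail (real m) (real a)
      \<le> gauss_tail (real m) (real a) - gauss_tail (real m) (real (a + h))"
    using gauss_tail_add_le[of "real m" "real a" "real h"] assms(1) by (simp add: algebra_simps)
  also have "\<dots> \<le> (\<Sum>t=a..<a + h. gauss_weight (real m) (real t))"
    using assms(1) by (intro gauss_tail_diff_le_sum) auto
  finally have "?e * ((1 - gauss_weight (real m) (real h)) * gauss_tail (real m) (real a))
      \<le> ?e * (\<Sum>t=a..<a + h. gauss_weight (real m) (real t))"
    by (rule mult_left_mono) simp
  also have "\<dots> = (\<Sum>t=a..<a + h. ?e * gauss_weight (real m) (real t))"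
    by (simp only: sum_distrib_left)
  also have "\<dots> \<le> (\<Sum>t=a..<a + h. birthday_prod m (Suc t))"
    using assms(2) by (intro sum_mono birthday_prod_ge) auto
  also have "\<dots> \<le> birthday_tail m a"
    unfolding birthday_tail_def using assms
    by (intro sum_mono2 birthday_prod_nonneg) auto
  finally show ?thesis by (simp add: birthday_lower_factor_def mult.assoc)
qed

lemma birthday_upper_factor_tendsto:
  assumes "(\<lambda>m. real (a m)) \<in> o(\<lambda>m. real m powr (2/3))"
  shows "(\<lambda>m. birthday_upper_factor m (a m) (real m powr (1/3))) \<longlonglongrightarrow> 1"
proof -
  define d where "d m = real m powr (1/3)" for m :: nat
  have "(\<lambda>m. real (a m) / real m powr (2/3) / 2 + real m powr (- 1/3) / 4) \<longlonglongrightarrow> 0 / 2 + 0"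
    by (intro tendsto_intros smalloD_tendsto[OF assms]) (simp, real_asymp)
  moreover have "\<forall>\<^sub>F m in sequentially. real (a m) / real m powr (2/3) / 2 + real m powr (- 1/3) / 4 =
      (2 * real (a m) * d m + (d m)\<^sup>2) / (4 * real m)"
    using eventually_gt_at_top[of 0]
  proof eventually_elim
    case (elim m)
    then have "d m > 0" "real m = d m ^ 3" "real m powr (2/3) = (d m)\<^sup>2" "real m powr (- 1/3) = 1 / d m"
      by (simp_all add: d_def powr_powr powr_minus_divide flip: powr_numeral)
    then show ?case by (simp add: field_simps power2_eq_square power3_eq_cube)
  qed
  ultimately have "(\<lambda>m. (2 * real (a m) * d m + (d m)\<^sup>2) / (4 * real m)) \<longlonglongrightarrow> 0"
    by (simp add: Lim_transform_eventually)
  moreover have "(\<lambda>m. exp (1 / (4 * real m))) \<longlonglongrightarrow> 1" "(\<lambda>m. inverse (d m)) \<longlonglongrightarrow> 0"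
    unfolding d_def by real_asymp+
  ultimately have "(\<lambda>m. exp (1 / (4 * real m)) *
      (1 + exp ((2 * real (a m) * d m + (d m)\<^sup>2) / (4 * real m)) * inverse (d m))) \<longlonglongrightarrow> 1 * (1 + exp 0 * 0)"
    by (intro tendsto_intros)
  then show ?thesis
    unfolding birthday_upper_factor_def d_def[symmetric] divide_inverse[of _ "d _"] by simp
qed

lemma birthday_lower_factor_tendsto:
  assumes "(\<lambda>m. real (a m + h m) / real m powr (2/3)) \<longlonglongrightarrow> 0"
    and "(\<lambda>m. gauss_weight (real m) (real (h m))) \<longlonglongrightarrow> 0"
  shows "(\<lambda>m. birthday_lower_factor m (a m) (h m)) \<longlonglongrightarrow> 1"
proof -
  have "(real m powr (2/3)) ^ 3 = (real m)\<^sup>2" for m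
    by (cases "m = 0") (simp_all add: powr_powr flip: powr_numeral)
  then have "real (a m + h m) ^ 3 / (real m)\<^sup>2 = (real (a m + h m) / real m powr (2/3)) ^ 3" for m
    by (simp only: power_divide)
  moreover have "(\<lambda>m. exp (- ((real (a m + h m) / real m powr (2/3)) ^ 3)) *
      (1 - gauss_weight (real m) (real (h m)))) \<longlonglongrightarrow> exp (- (0 ^ 3)) * (1 - 0)"
    by (intro tendsto_intros assms)
  ultimately show ?thesis by (simp add: birthday_lower_factor_def)
qed

lemma eventually_le_of_divide_powr_tendsto_0:
  fixes n :: "nat \<Rightarrow> nat"
  assumes "(\<lambda>m. real (n m) / real m powr (2/3)) \<longlonglongrightarrow> 0"
  shows "\<forall>\<^sub>F m in sequentially. n m \<le> m"
proof -
  have "\<forall>\<^sub>F m in sequentially. real (n m) / real m powr (2/3) < 1"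
    using assms by (rule order_tendstoD) simp
  then show ?thesis
    using eventually_ge_at_top[of 1]
  proof eventually_elim
    case (elim m)
    then have "real (n m) < real m powr (2/3)" by simp
    also have "\<dots> \<le> real m powr 1" using elim by (intro powr_mono) auto
    finally show ?case using elim by simp
  qed
qed

text \<open>The offsets \<open>d = m powr (1/3)\<close> and \<open>h = \<lceil>m powr (3/5)\<rceil>\<close> make both factors tend to 1:
  \<open>a * d\<close> and \<open>d\<^sup>2\<close> are \<open>o(m)\<close> while \<open>d\<close> is unbounded, and \<open>h\<close> grows faster than \<open>sqrt m\<close> while
  \<open>(a + h) ^ 3 = o(m\<^sup>2)\<close>.\<close>

theorem birthday_tail_asymp_equiv:
  assumes small: "(\<lambda>m. real (a m)) \<in> o(\<lambda>m. real m powr (2/3))"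
  shows "(\<lambda>m. birthday_tail m (a m)) \<sim>[at_top] (\<lambda>m. gauss_tail (real m) (real (a m)))"
proof -
  define h where "h m = nat \<lceil>real m powr (3/5)\<rceil>" for m :: nat
  let ?G = "\<lambda>m. gauss_tail (real m) (real (a m))" and ?d = "\<lambda>m. real m powr (1/3)"
  let ?lower = "\<lambda>m. birthday_lower_factor m (a m) (h m)"
  let ?upper = "\<lambda>m. birthday_upper_factor m (a m) (?d m)"
  have equiv: "(\<lambda>m. c m * ?G m) \<sim>[at_top] ?G" if "c \<longlonglongrightarrow> 1" for c
    using asymp_equiv_mult[OF tendsto_imp_asymp_equiv_const[OF that] asymp_equiv_refl] by simp
  have "(\<lambda>m. real (a m) / real m powr (2/3) + real (h m) / real m powr (2/3)) \<longlonglongrightarrow> 0 + 0"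
    unfolding h_def by (intro tendsto_add smalloD_tendsto[OF small]) real_asymp
  then have endpoint: "(\<lambda>m. real (a m + h m) / real m powr (2/3)) \<longlonglongrightarrow> 0"
    by (simp add: add_divide_distrib)
  have "(\<lambda>m. gauss_weight (real m) (real (h m))) \<longlonglongrightarrow> 0"
    unfolding h_def gauss_weight_def by real_asymp
  then have "?lower \<longlonglongrightarrow> 1" using endpoint by (intro birthday_lower_factor_tendsto)
  then have "(\<lambda>m. ?lower m * ?G m) \<sim>[at_top] ?G" by (rule equiv)
  moreover have "(\<lambda>m. ?upper m * ?G m) \<sim>[at_top] ?G"
    by (rule equiv[OF birthday_upper_factor_tendsto[OF small]])
  moreover have "\<forall>\<^sub>F m in sequentially. birthday_tail m (a m) \<in> {?lower m * ?G m..?upper m * ?G m}"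
    using eventually_le_of_divide_powr_tendsto_0[OF endpoint] eventually_ge_at_top[of 1]
    by eventually_elim (simp add: birthday_tail_ge birthday_tail_le)
  ultimately show ?thesis by (rule asymp_equiv_sandwich_real)
qed

lemma smallo_double_minus_1:
  assumes "(\<lambda>m. real (k m)) \<in> o(g)"
  shows "(\<lambda>m. real (2 * k m - 1)) \<in> o(g)"
proof -
  have "(\<lambda>m. real (2 * k m - 1)) \<in> O(\<lambda>m. real (k m))" by (intro bigoI[of _ 2] always_eventually) auto
  then show ?thesis using assms by (rule landau_o.big_small_trans)
qed

lemma sqrt_mult_divide_self: "0 \<le> x \<Longrightarrow> sqrt (c * x) / x = sqrt (c / x)"
  using sqrt_divide_self_eq[of x] by (simp add: real_sqrt_mult real_sqrt_inverse divide_inverse)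

context atomless_distribution
begin

lemma cycle_prob_asymp_equiv_gauss_tail:
  assumes k: "\<And>m. k m \<ge> 1" and small: "(\<lambda>m. real (k m)) \<in> o(\<lambda>m. real m powr (2/3))"
  shows "(\<lambda>m. cycle_prob D m (k m)) \<sim>[at_top] (\<lambda>m. gauss_tail (real m) (real (2 * k m - 1)) / real m)"
proof -
  have "(\<lambda>m. birthday_tail m (2 * k m - 1) / real m) \<sim>[at_top]
      (\<lambda>m. gauss_tail (real m) (real (2 * k m - 1)) / real m)"
    by (intro asymp_equiv_divide asymp_equiv_refl birthday_tail_asymp_equiv smallo_double_minus_1 small)
  moreover have "\<forall>\<^sub>F m in sequentially. birthday_tail m (2 * k m - 1) / real m = cycle_prob D m (k m)"
    using eventually_ge_at_top[of 1] by eventually_elim (simp add: cycle_prob_eq[OF _ k])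
  ultimately show ?thesis by (rule asymp_equiv_transfer) simp
qed

lemma cycle_prob_asymp_equiv_Phi:
  assumes k: "\<And>m. k m \<ge> 1" and "(\<lambda>m. real (k m)) \<in> o(\<lambda>m. real m powr (2/3))"
  shows "(\<lambda>m. cycle_prob D m (k m)) \<sim>[at_top]
    (\<lambda>m. 2 * sqrt (pi / real m) * (1 - Phi ((2 * real (k m) - 1) / sqrt (2 * real m))))"
proof -
  have "gauss_tail (real m) (real (2 * k m - 1)) / real m =
      2 * sqrt (pi / real m) * (1 - Phi ((2 * real (k m) - 1) / sqrt (2 * real m)))" for m
    using k[of m] by (simp add: gauss_tail_def of_nat_diff flip: sqrt_mult_divide_self)
  with cycle_prob_asymp_equiv_gauss_tail[OF assms] show ?thesis by (simp only:)
qed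

lemma cycle_prob_asymp_equiv_sqrt:
  assumes k: "\<And>m. k m \<ge> 1" and small: "(\<lambda>m. real (k m)) \<in> o(\<lambda>m. sqrt (real m))"
  shows "(\<lambda>m. cycle_prob D m (k m)) \<sim>[at_top] (\<lambda>m. sqrt (pi / real m))"
proof -
  have "(\<lambda>m::nat. sqrt (real m)) \<in> O(\<lambda>m. real m powr (2/3))" by real_asymp
  with small have "(\<lambda>m. real (k m)) \<in> o(\<lambda>m. real m powr (2/3))" by (rule landau_o.small_big_trans)
  with k have "(\<lambda>m. cycle_prob D m (k m)) \<sim>[at_top] (\<lambda>m. gauss_tail (real m) (real (2 * k m - 1)) / real m)"
    by (rule cycle_prob_asymp_equiv_gauss_tail)
  also have "\<dots> \<sim>[at_top] (\<lambda>m. sqrt (pi * real m) / real m)"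
    by (intro asymp_equiv_divide asymp_equiv_refl gauss_tail_asymp_equiv smallo_double_minus_1 small)
  also have "\<dots> = (\<lambda>m. sqrt (pi / real m))" by (simp add: sqrt_mult_divide_self)
  finally show ?thesis .
qed

end

theorem proposition3:
  fixes D :: "real measure" and k :: "nat \<Rightarrow> nat"
  assumes "prob_space D"
    and "sets D = sets borel"
    and "\<And>x. measure D {x} = 0"
    and "\<And>m. k m \<ge> 1"
  shows "((\<lambda>m. real (k m)) \<in> o(\<lambda>m. real m powr (2/3)) \<longrightarrow>
           (\<lambda>m. cycle_prob D m (k m)) \<sim>[at_top]
           (\<lambda>m. 2 * sqrt (pi / real m) * (1 - Phi ((2 * real (k m) - 1) / sqrt (2 * real m)))))
       \<and> ((\<lambda>m. real (k m)) \<in> o(\<lambda>m. sqrt (real m)) \<longrightarrow>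
           (\<lambda>m. cycle_prob D m (k m)) \<sim>[at_top] (\<lambda>m. sqrt (pi / real m)))"
proof -
  interpret real_distribution D
    using assms(1,2) by (simp add: real_distribution_def real_distribution_axioms_def)
  interpret atomless_distribution D by unfold_locales (rule assms(3))
  show ?thesis using cycle_prob_asymp_equiv_Phi cycle_prob_asymp_equiv_sqrt assms(4) by blast
qed

end
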